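(* For every set $S$, the free (unitless) linearly distributive category $F^{\mathrm{LD}}_S$ on $S$ is thin; equivalently, every formal diagram in a unitless linearly distributive category commutes. The same holds for unitless lax linearly distributive categories: the free unitless lax linearly distributive category on any set $S$ is thin, equivalently every formal diagram in a unitless lax linearly distributive category commutes.
   Context: A (unitless) lax linearly distributive (LD) category is a category $\mathcal C$ with two bifunctors $\otimes,\odot:\mathcal C\times\mathcal C\to\mathcal C$ (no unit objects are assumed; $\odot$ plays the role of the "par" product) and natural transformations, not necessarily invertible, $\alpha_{A,B,C}:A\otimes(B\otimes C)\to(A\otimes B)\otimes C$, $\bar\alpha_{A,B,C}:A\odot(B\odot C)\to(A\odot B)\odot C$ (associators), $\delta^l_{A,B,C}:A\otimes(B\odot C)\to(A\otimes B)\odot C$, $\delta^r_{A,B,C}:(A\odot B)\otimes C\to A\odot(B\otimes C)$ (distributors), such that for all objects $A,B,C,D$ (writing an object for its identity morphism): (P1) $\alpha_{A\otimes B,C,D}\circ\alpha_{A,B,C\otimes D}=(\alpha_{A,B,C}\otimes D)\circ\alpha_{A,B\otimes C,D}\circ(A\otimes\alpha_{B,C,D})$; (P2) $\delta^l_{A\otimes B,C,D}\circ\alpha_{A,B,C\odot D}=(\alpha_{A,B,C}\odot D)\circ\delta^l_{A,B\otimes C,D}\circ(A\otimes\delta^l_{B,C,D})$; (P3) $\delta^l_{A,B,C\otimes D}\circ(A\otimes\delta^r_{B,C,D})=\delta^r_{A\otimes B,C,D}\circ(\delta^l_{A,B,C}\otimes D)\circ\alpha_{A,B\odot C,D}$;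 (P4) $\bar\alpha_{A\otimes B,C,D}\circ\delta^l_{A,B,C\odot D}=(\delta^l_{A,B,C}\odot D)\circ\delta^l_{A,B\odot C,D}\circ(A\otimes\bar\alpha_{B,C,D})$; (P5) $(A\odot\alpha_{B,C,D})\circ\delta^r_{A,B,C\otimes D}=\delta^r_{A,B\otimes C,D}\circ(\delta^r_{A,B,C}\otimes D)\circ\alpha_{A\odot B,C,D}$; (P6) $(\delta^r_{A,B,C}\odot D)\circ\delta^l_{A\odot B,C,D}=\bar\alpha_{A,B\otimes C,D}\circ(A\odot\delta^l_{B,C,D})\circ\delta^r_{A,B,C\odot D}$; (P7) $\delta^r_{A\odot B,C,D}\circ(\bar\alpha_{A,B,C}\otimes D)=\bar\alpha_{A,B,C\otimes D}\circ(A\odot\delta^r_{B,C,D})\circ\delta^r_{A,B\odot C,D}$; (P8) $\bar\alpha_{A\odot B,C,D}\circ\bar\alpha_{A,B,C\odot D}=(\bar\alpha_{A,B,C}\odot D)\circ\bar\alpha_{A,B\odot C,D}\circ(A\odot\bar\alpha_{B,C,D})$. An LD category is a lax LD category in which $\alpha$ and $\bar\alpha$ are invertible. A strict structure-preserving functor between LD categories is a functor strictly preserving $\otimes,\odot$ and the components of $\alpha,\bar\alpha,\delta^l,\delta^r$. The free LD category $F^{\mathrm{LD}}_S$ on a set $S$: its objects are the formal expressions generated from $S$ by the binary operations $\otimes$ and $\odot$; its morphisms are generated by identities and components of $\alpha,\alpha^{-1},\bar\alpha,\bar\alpha^{-1},\delta^l,\delta^r$ under composition, $\otimes$ and $\odot$,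 modulo exactly the relations making it a category, $\otimes,\odot$ bifunctors, $\alpha,\bar\alpha,\delta^l,\delta^r$ natural, $\alpha^{\pm1}$ and $\bar\alpha^{\pm1}$ mutually inverse, and (P1)–(P8) hold. It has the universal property: every function from $S$ to the objects of an LD category $\mathcal C$ extends uniquely to a strict structure-preserving functor $F^{\mathrm{LD}}_S\to\mathcal C$. The free lax LD category is defined analogously, omitting $\alpha^{-1},\bar\alpha^{-1}$. A category is thin if between any two objects there is at most one morphism. For an LD category $\mathcal C$, let $\varepsilon_{\mathcal C}:F^{\mathrm{LD}}_{\mathrm{Ob}(\mathcal C)}\to\mathcal C$ be the strict functor extending the identity on objects; a diagram $D:J\to\mathcal C$ is formal if $D=\varepsilon_{\mathcal C}\circ D^\sharp$ for some diagram $D^\sharp:J\to F^{\mathrm{LD}}_{\mathrm{Ob}(\mathcal C)}$ (analogously for lax LD categories). *)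

theory Defs
  imports Main
begin

section \<open>Categories, functors, diagrams\<close>

record ('o, 'm) category =
  Ob :: "'o set"
  Ar :: "'m set"
  dom :: "'m \<Rightarrow> 'o"
  cod :: "'m \<Rightarrow> 'o"
  ident :: "'o \<Rightarrow> 'm"  ("\<one>\<index>")
  comp :: "'m \<Rightarrow> 'm \<Rightarrow> 'm"  (infixr "\<cdot>\<index>" 55)

definition hom :: "('o, 'm, 'z) category_scheme \<Rightarrow> 'o \<Rightarrow> 'o \<Rightarrow> 'm set" where
  "hom \<C> A B = {f \<in> Ar \<C>. dom \<C> f = A \<and> cod \<C> f = B}"

locale category =
  fixes \<C> :: "('o, 'm, 'z) category_scheme" (structure)
  assumes dom_in: "f \<in> Ar \<C> \<Longrightarrow> dom \<C> f \<in> Ob \<C>"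
    and cod_in: "f \<in> Ar \<C> \<Longrightarrow> cod \<C> f \<in> Ob \<C>"
    and ident_hom: "A \<in> Ob \<C> \<Longrightarrow> \<one> A \<in> hom \<C> A A"
    and comp_hom: "\<lbrakk>f \<in> hom \<C> A B; g \<in> hom \<C> B D\<rbrakk> \<Longrightarrow> g \<cdot> f \<in> hom \<C> A D"
    and ident_left: "f \<in> hom \<C> A B \<Longrightarrow> \<one> B \<cdot> f = f"
    and ident_right: "f \<in> hom \<C> A B \<Longrightarrow> f \<cdot> \<one> A = f"
    and comp_assoc: "\<lbrakk>f \<in> hom \<C> A B; g \<in> hom \<C> B D; h \<in> hom \<C> D E\<rbrakk>
      \<Longrightarrow> (h \<cdot> g) \<cdot> f = h \<cdot> (g \<cdot> f)"

definition inverse_arrows :: "('o, 'm, 'z) category_scheme \<Rightarrow> 'm \<Rightarrow> 'm \<Rightarrow> bool" where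
  "inverse_arrows \<C> f g \<longleftrightarrow> f \<in> Ar \<C> \<and> g \<in> hom \<C> (cod \<C> f) (dom \<C> f) \<and>
     comp \<C> g f = ident \<C> (dom \<C> f) \<and> comp \<C> f g = ident \<C> (cod \<C> f)"

definition iso_arrow :: "('o, 'm, 'z) category_scheme \<Rightarrow> 'm \<Rightarrow> bool" where
  "iso_arrow \<C> f \<longleftrightarrow> (\<exists>g. inverse_arrows \<C> f g)"

definition inv_arrow :: "('o, 'm, 'z) category_scheme \<Rightarrow> 'm \<Rightarrow> 'm" where
  "inv_arrow \<C> f = (THE g. inverse_arrows \<C> f g)"

definition thin :: "('o, 'm, 'z) category_scheme \<Rightarrow> bool" where
  "thin \<C> \<longleftrightarrow> (\<forall>A \<in> Ob \<C>. \<forall>B \<in> Ob \<C>. \<forall>f \<in> hom \<C> A B. \<forall>g \<in> hom \<C> A B. f = g)"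

text \<open>Object and arrow maps are total; only their values on the carriers of the source category
  are meaningful.\<close>

record ('o, 'm, 'p, 'n) fctr =
  onO :: "'o \<Rightarrow> 'p"
  onA :: "'m \<Rightarrow> 'n"

definition is_functor :: "('o, 'm, 'y) category_scheme \<Rightarrow> ('p, 'n, 'z) category_scheme
    \<Rightarrow> ('o, 'm, 'p, 'n) fctr \<Rightarrow> bool" where
  "is_functor \<C> \<D> F \<longleftrightarrow>
     (\<forall>A \<in> Ob \<C>. onO F A \<in> Ob \<D>) \<and>
     (\<forall>A \<in> Ob \<C>. \<forall>B \<in> Ob \<C>. \<forall>f \<in> hom \<C> A B. onA F f \<in> hom \<D> (onO F A) (onO F B)) \<and>
     (\<forall>A \<in> Ob \<C>. onA F (ident \<C> A) = ident \<D> (onO F A)) \<and>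
     (\<forall>f \<in> Ar \<C>. \<forall>g \<in> Ar \<C>. cod \<C> f = dom \<C> g \<longrightarrow>
        onA F (comp \<C> g f) = comp \<D> (onA F g) (onA F f))"

definition comp_functor :: "('p, 'n, 'q, 'l) fctr \<Rightarrow> ('o, 'm, 'p, 'n) fctr
    \<Rightarrow> ('o, 'm, 'q, 'l) fctr" where
  "comp_functor G F = \<lparr>onO = onO G \<circ> onO F, onA = onA G \<circ> onA F\<rparr>"

definition eq_functor_on :: "('o, 'm, 'z) category_scheme \<Rightarrow> ('o, 'm, 'p, 'n) fctr
    \<Rightarrow> ('o, 'm, 'p, 'n) fctr \<Rightarrow> bool" where
  "eq_functor_on \<C> F G \<longleftrightarrow>
     (\<forall>A \<in> Ob \<C>. onO F A = onO G A) \<and> (\<forall>f \<in> Ar \<C>. onA F f = onA G f)"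

text \<open>A diagram of shape \<open>\<J>\<close> is a functor out of \<open>\<J>\<close>; it commutes when parallel arrows of
  \<open>\<J>\<close> have equal images. Taking \<open>\<J>\<close> to be a path category covers diagrams indexed by
  directed graphs.\<close>

definition commutes :: "('j, 'k, 'z) category_scheme \<Rightarrow> ('j, 'k, 'o, 'm) fctr \<Rightarrow> bool" where
  "commutes \<J> D \<longleftrightarrow>
     (\<forall>i \<in> Ob \<J>. \<forall>j \<in> Ob \<J>. \<forall>u \<in> hom \<J> i j. \<forall>v \<in> hom \<J> i j. onA D u = onA D v)"


section \<open>Unitless lax linearly distributive categories\<close>

text \<open>The suffix \<open>a\<close> marks the action of the two products on arrows; \<open>\<beta>\<close> is the associator
  written $\bar\alpha$ on paper.\<close>

record ('o, 'm) ld_structure = "('o, 'm) category" +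
  tenO :: "'o \<Rightarrow> 'o \<Rightarrow> 'o"  (infixr "\<otimes>\<index>" 70)
  tenA :: "'m \<Rightarrow> 'm \<Rightarrow> 'm"  (infixr "\<otimes>\<^sub>a\<index>" 70)
  parO :: "'o \<Rightarrow> 'o \<Rightarrow> 'o"  (infixr "\<odot>\<index>" 70)
  parA :: "'m \<Rightarrow> 'm \<Rightarrow> 'm"  (infixr "\<odot>\<^sub>a\<index>" 70)
  assoc_ten :: "'o \<Rightarrow> 'o \<Rightarrow> 'o \<Rightarrow> 'm"  ("\<alpha>\<index>")
  assoc_par :: "'o \<Rightarrow> 'o \<Rightarrow> 'o \<Rightarrow> 'm"  ("\<beta>\<index>")
  dist_l :: "'o \<Rightarrow> 'o \<Rightarrow> 'o \<Rightarrow> 'm"  ("\<delta>\<^sup>l\<index>")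
  dist_r :: "'o \<Rightarrow> 'o \<Rightarrow> 'o \<Rightarrow> 'm"  ("\<delta>\<^sup>r\<index>")

locale lax_ld_category = category \<C>
  for \<C> :: "('o, 'm, 'z) ld_structure_scheme" (structure) +
  assumes ten_ob: "\<lbrakk>A \<in> Ob \<C>; B \<in> Ob \<C>\<rbrakk> \<Longrightarrow> A \<otimes> B \<in> Ob \<C>"
    and ten_hom: "\<lbrakk>f \<in> hom \<C> A A'; g \<in> hom \<C> B B'\<rbrakk> \<Longrightarrow> f \<otimes>\<^sub>a g \<in> hom \<C> (A \<otimes> B) (A' \<otimes> B')"
    and ten_ident: "\<lbrakk>A \<in> Ob \<C>; B \<in> Ob \<C>\<rbrakk> \<Longrightarrow> \<one> A \<otimes>\<^sub>a \<one> B = \<one> (A \<otimes> B)"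
    and ten_comp: "\<lbrakk>f \<in> hom \<C> A A'; f' \<in> hom \<C> A' A''; g \<in> hom \<C> B B'; g' \<in> hom \<C> B' B''\<rbrakk>
      \<Longrightarrow> (f' \<cdot> f) \<otimes>\<^sub>a (g' \<cdot> g) = (f' \<otimes>\<^sub>a g') \<cdot> (f \<otimes>\<^sub>a g)"
    and par_ob: "\<lbrakk>A \<in> Ob \<C>; B \<in> Ob \<C>\<rbrakk> \<Longrightarrow> A \<odot> B \<in> Ob \<C>"
    and par_hom: "\<lbrakk>f \<in> hom \<C> A A'; g \<in> hom \<C> B B'\<rbrakk> \<Longrightarrow> f \<odot>\<^sub>a g \<in> hom \<C> (A \<odot> B) (A' \<odot> B')"
    and par_ident: "\<lbrakk>A \<in> Ob \<C>; B \<in> Ob \<C>\<rbrakk> \<Longrightarrow> \<one> A \<odot>\<^sub>a \<one> B = \<one> (A \<odot> B)"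
    and par_comp: "\<lbrakk>f \<in> hom \<C> A A'; f' \<in> hom \<C> A' A''; g \<in> hom \<C> B B'; g' \<in> hom \<C> B' B''\<rbrakk>
      \<Longrightarrow> (f' \<cdot> f) \<odot>\<^sub>a (g' \<cdot> g) = (f' \<odot>\<^sub>a g') \<cdot> (f \<odot>\<^sub>a g)"
    and assoc_ten_hom: "\<lbrakk>A \<in> Ob \<C>; B \<in> Ob \<C>; C \<in> Ob \<C>\<rbrakk>
      \<Longrightarrow> \<alpha> A B C \<in> hom \<C> (A \<otimes> (B \<otimes> C)) ((A \<otimes> B) \<otimes> C)"
    and assoc_par_hom: "\<lbrakk>A \<in> Ob \<C>; B \<in> Ob \<C>; C \<in> Ob \<C>\<rbrakk>
      \<Longrightarrow> \<beta> A B C \<in> hom \<C> (A \<odot> (B \<odot> C)) ((A \<odot> B) \<odot> C)"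
    and dist_l_hom: "\<lbrakk>A \<in> Ob \<C>; B \<in> Ob \<C>; C \<in> Ob \<C>\<rbrakk>
      \<Longrightarrow> \<delta>\<^sup>l A B C \<in> hom \<C> (A \<otimes> (B \<odot> C)) ((A \<otimes> B) \<odot> C)"
    and dist_r_hom: "\<lbrakk>A \<in> Ob \<C>; B \<in> Ob \<C>; C \<in> Ob \<C>\<rbrakk>
      \<Longrightarrow> \<delta>\<^sup>r A B C \<in> hom \<C> ((A \<odot> B) \<otimes> C) (A \<odot> (B \<otimes> C))"
    and assoc_ten_nat: "\<lbrakk>f \<in> hom \<C> A A'; g \<in> hom \<C> B B'; h \<in> hom \<C> C C'\<rbrakk>
      \<Longrightarrow> \<alpha> A' B' C' \<cdot> (f \<otimes>\<^sub>a (g \<otimes>\<^sub>a h)) = ((f \<otimes>\<^sub>a g) \<otimes>\<^sub>a h) \<cdot> \<alpha> A B C"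
    and assoc_par_nat: "\<lbrakk>f \<in> hom \<C> A A'; g \<in> hom \<C> B B'; h \<in> hom \<C> C C'\<rbrakk>
      \<Longrightarrow> \<beta> A' B' C' \<cdot> (f \<odot>\<^sub>a (g \<odot>\<^sub>a h)) = ((f \<odot>\<^sub>a g) \<odot>\<^sub>a h) \<cdot> \<beta> A B C"
    and dist_l_nat: "\<lbrakk>f \<in> hom \<C> A A'; g \<in> hom \<C> B B'; h \<in> hom \<C> C C'\<rbrakk>
      \<Longrightarrow> \<delta>\<^sup>l A' B' C' \<cdot> (f \<otimes>\<^sub>a (g \<odot>\<^sub>a h)) = ((f \<otimes>\<^sub>a g) \<odot>\<^sub>a h) \<cdot> \<delta>\<^sup>l A B C"
    and dist_r_nat: "\<lbrakk>f \<in> hom \<C> A A'; g \<in> hom \<C> B B'; h \<in> hom \<C> C C'\<rbrakk>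
      \<Longrightarrow> \<delta>\<^sup>r A' B' C' \<cdot> ((f \<odot>\<^sub>a g) \<otimes>\<^sub>a h) = (f \<odot>\<^sub>a (g \<otimes>\<^sub>a h)) \<cdot> \<delta>\<^sup>r A B C"
    and P1: "\<lbrakk>A \<in> Ob \<C>; B \<in> Ob \<C>; C \<in> Ob \<C>; D \<in> Ob \<C>\<rbrakk> \<Longrightarrow>
      \<alpha> (A \<otimes> B) C D \<cdot> \<alpha> A B (C \<otimes> D)
      = (\<alpha> A B C \<otimes>\<^sub>a \<one> D) \<cdot> \<alpha> A (B \<otimes> C) D \<cdot> (\<one> A \<otimes>\<^sub>a \<alpha> B C D)"
    and P2: "\<lbrakk>A \<in> Ob \<C>; B \<in> Ob \<C>; C \<in> Ob \<C>; D \<in> Ob \<C>\<rbrakk> \<Longrightarrow>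
      \<delta>\<^sup>l (A \<otimes> B) C D \<cdot> \<alpha> A B (C \<odot> D)
      = (\<alpha> A B C \<odot>\<^sub>a \<one> D) \<cdot> \<delta>\<^sup>l A (B \<otimes> C) D \<cdot> (\<one> A \<otimes>\<^sub>a \<delta>\<^sup>l B C D)"
    and P3: "\<lbrakk>A \<in> Ob \<C>; B \<in> Ob \<C>; C \<in> Ob \<C>; D \<in> Ob \<C>\<rbrakk> \<Longrightarrow>
      \<delta>\<^sup>l A B (C \<otimes> D) \<cdot> (\<one> A \<otimes>\<^sub>a \<delta>\<^sup>r B C D)
      = \<delta>\<^sup>r (A \<otimes> B) C D \<cdot> (\<delta>\<^sup>l A B C \<otimes>\<^sub>a \<one> D) \<cdot> \<alpha> A (B \<odot> C) D"
    and P4: "\<lbrakk>A \<in> Ob \<C>; B \<in> Ob \<C>; C \<in> Ob \<C>; D \<in> Ob \<C>\<rbrakk> \<Longrightarrow>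
      \<beta> (A \<otimes> B) C D \<cdot> \<delta>\<^sup>l A B (C \<odot> D)
      = (\<delta>\<^sup>l A B C \<odot>\<^sub>a \<one> D) \<cdot> \<delta>\<^sup>l A (B \<odot> C) D \<cdot> (\<one> A \<otimes>\<^sub>a \<beta> B C D)"
    and P5: "\<lbrakk>A \<in> Ob \<C>; B \<in> Ob \<C>; C \<in> Ob \<C>; D \<in> Ob \<C>\<rbrakk> \<Longrightarrow>
      (\<one> A \<odot>\<^sub>a \<alpha> B C D) \<cdot> \<delta>\<^sup>r A B (C \<otimes> D)
      = \<delta>\<^sup>r A (B \<otimes> C) D \<cdot> (\<delta>\<^sup>r A B C \<otimes>\<^sub>a \<one> D) \<cdot> \<alpha> (A \<odot> B) C D"
    and P6: "\<lbrakk>A \<in> Ob \<C>; B \<in> Ob \<C>; C \<in> Ob \<C>; D \<in> Ob \<C>\<rbrakk> \<Longrightarrow>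
      (\<delta>\<^sup>r A B C \<odot>\<^sub>a \<one> D) \<cdot> \<delta>\<^sup>l (A \<odot> B) C D
      = \<beta> A (B \<otimes> C) D \<cdot> (\<one> A \<odot>\<^sub>a \<delta>\<^sup>l B C D) \<cdot> \<delta>\<^sup>r A B (C \<odot> D)"
    and P7: "\<lbrakk>A \<in> Ob \<C>; B \<in> Ob \<C>; C \<in> Ob \<C>; D \<in> Ob \<C>\<rbrakk> \<Longrightarrow>
      \<delta>\<^sup>r (A \<odot> B) C D \<cdot> (\<beta> A B C \<otimes>\<^sub>a \<one> D)
      = \<beta> A B (C \<otimes> D) \<cdot> (\<one> A \<odot>\<^sub>a \<delta>\<^sup>r B C D) \<cdot> \<delta>\<^sup>r A (B \<odot> C) D"
    and P8: "\<lbrakk>A \<in> Ob \<C>; B \<in> Ob \<C>; C \<in> Ob \<C>; D \<in> Ob \<C>\<rbrakk> \<Longrightarrow>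
      \<beta> (A \<odot> B) C D \<cdot> \<beta> A B (C \<odot> D)
      = (\<beta> A B C \<odot>\<^sub>a \<one> D) \<cdot> \<beta> A (B \<odot> C) D \<cdot> (\<one> A \<odot>\<^sub>a \<beta> B C D)"

locale ld_category = lax_ld_category +
  assumes assoc_ten_iso: "\<lbrakk>A \<in> Ob \<C>; B \<in> Ob \<C>; C \<in> Ob \<C>\<rbrakk> \<Longrightarrow> iso_arrow \<C> (\<alpha> A B C)"
    and assoc_par_iso: "\<lbrakk>A \<in> Ob \<C>; B \<in> Ob \<C>; C \<in> Ob \<C>\<rbrakk> \<Longrightarrow> iso_arrow \<C> (\<beta> A B C)"

definition strict_ld_functor :: "('o, 'm, 'y) ld_structure_scheme
    \<Rightarrow> ('p, 'n, 'z) ld_structure_scheme \<Rightarrow> ('o, 'm, 'p, 'n) fctr \<Rightarrow> bool" where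
  "strict_ld_functor \<C> \<D> F \<longleftrightarrow> is_functor \<C> \<D> F \<and>
     (\<forall>A \<in> Ob \<C>. \<forall>B \<in> Ob \<C>.
        onO F (tenO \<C> A B) = tenO \<D> (onO F A) (onO F B) \<and>
        onO F (parO \<C> A B) = parO \<D> (onO F A) (onO F B)) \<and>
     (\<forall>f \<in> Ar \<C>. \<forall>g \<in> Ar \<C>.
        onA F (tenA \<C> f g) = tenA \<D> (onA F f) (onA F g) \<and>
        onA F (parA \<C> f g) = parA \<D> (onA F f) (onA F g)) \<and>
     (\<forall>A \<in> Ob \<C>. \<forall>B \<in> Ob \<C>. \<forall>C \<in> Ob \<C>.
        onA F (assoc_ten \<C> A B C) = assoc_ten \<D> (onO F A) (onO F B) (onO F C) \<and>
        onA F (assoc_par \<C> A B C) = assoc_par \<D> (onO F A) (onO F B) (onO F C) \<and>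
        onA F (dist_l \<C> A B C) = dist_l \<D> (onO F A) (onO F B) (onO F C) \<and>
        onA F (dist_r \<C> A B C) = dist_r \<D> (onO F A) (onO F B) (onO F C))"


section \<open>The free (lax) linearly distributive category\<close>

datatype flavour = Lax | LD

datatype (gens: 'a) expr =
    Gen 'a
  | Ten "'a expr" "'a expr"  (infixr "\<otimes>\<^sub>e" 70)
  | Par "'a expr" "'a expr"  (infixr "\<odot>\<^sub>e" 70)

definition exprs :: "'a set \<Rightarrow> 'a expr set" where
  "exprs S = {A. gens A \<subseteq> S}"

text \<open>Raw arrow terms; \<open>g \<circ>\<^sub>t f\<close> means \<open>g\<close> after \<open>f\<close>.\<close>

datatype 'a arrow_term =
    Idt "'a expr"
  | Al "'a expr" "'a expr" "'a expr"
  | AlInv "'a expr" "'a expr" "'a expr"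
  | Be "'a expr" "'a expr" "'a expr"
  | BeInv "'a expr" "'a expr" "'a expr"
  | Dl "'a expr" "'a expr" "'a expr"
  | Dr "'a expr" "'a expr" "'a expr"
  | Cmp "'a arrow_term" "'a arrow_term"  (infixr "\<circ>\<^sub>t" 55)
  | TenT "'a arrow_term" "'a arrow_term"  (infixr "\<otimes>\<^sub>t" 70)
  | ParT "'a arrow_term" "'a arrow_term"  (infixr "\<odot>\<^sub>t" 70)

primrec src :: "'a arrow_term \<Rightarrow> 'a expr" where
  "src (Idt A) = A"
| "src (Al A B C) = A \<otimes>\<^sub>e (B \<otimes>\<^sub>e C)"
| "src (AlInv A B C) = (A \<otimes>\<^sub>e B) \<otimes>\<^sub>e C"
| "src (Be A B C) = A \<odot>\<^sub>e (B \<odot>\<^sub>e C)"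
| "src (BeInv A B C) = (A \<odot>\<^sub>e B) \<odot>\<^sub>e C"
| "src (Dl A B C) = A \<otimes>\<^sub>e (B \<odot>\<^sub>e C)"
| "src (Dr A B C) = (A \<odot>\<^sub>e B) \<otimes>\<^sub>e C"
| "src (g \<circ>\<^sub>t f) = src f"
| "src (f \<otimes>\<^sub>t g) = src f \<otimes>\<^sub>e src g"
| "src (f \<odot>\<^sub>t g) = src f \<odot>\<^sub>e src g"

primrec tgt :: "'a arrow_term \<Rightarrow> 'a expr" where
  "tgt (Idt A) = A"
| "tgt (Al A B C) = (A \<otimes>\<^sub>e B) \<otimes>\<^sub>e C"
| "tgt (AlInv A B C) = A \<otimes>\<^sub>e (B \<otimes>\<^sub>e C)"
| "tgt (Be A B C) = (A \<odot>\<^sub>e B) \<odot>\<^sub>e C"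
| "tgt (BeInv A B C) = A \<odot>\<^sub>e (B \<odot>\<^sub>e C)"
| "tgt (Dl A B C) = (A \<otimes>\<^sub>e B) \<odot>\<^sub>e C"
| "tgt (Dr A B C) = A \<odot>\<^sub>e (B \<otimes>\<^sub>e C)"
| "tgt (g \<circ>\<^sub>t f) = tgt g"
| "tgt (f \<otimes>\<^sub>t g) = tgt f \<otimes>\<^sub>e tgt g"
| "tgt (f \<odot>\<^sub>t g) = tgt f \<odot>\<^sub>e tgt g"

text \<open>Well-formed terms; the formal inverses exist only in the \<^const>\<open>LD\<close> flavour.\<close>

primrec wf_term :: "flavour \<Rightarrow> 'a set \<Rightarrow> 'a arrow_term \<Rightarrow> bool" where
  "wf_term k S (Idt A) \<longleftrightarrow> A \<in> exprs S"
| "wf_term k S (Al A B C) \<longleftrightarrow> A \<in> exprs S \<and> B \<in> exprs S \<and> C \<in> exprs S"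
| "wf_term k S (AlInv A B C) \<longleftrightarrow> k = LD \<and> A \<in> exprs S \<and> B \<in> exprs S \<and> C \<in> exprs S"
| "wf_term k S (Be A B C) \<longleftrightarrow> A \<in> exprs S \<and> B \<in> exprs S \<and> C \<in> exprs S"
| "wf_term k S (BeInv A B C) \<longleftrightarrow> k = LD \<and> A \<in> exprs S \<and> B \<in> exprs S \<and> C \<in> exprs S"
| "wf_term k S (Dl A B C) \<longleftrightarrow> A \<in> exprs S \<and> B \<in> exprs S \<and> C \<in> exprs S"
| "wf_term k S (Dr A B C) \<longleftrightarrow> A \<in> exprs S \<and> B \<in> exprs S \<and> C \<in> exprs S"
| "wf_term k S (g \<circ>\<^sub>t f) \<longleftrightarrow> wf_term k S g \<and> wf_term k S f \<and> src g = tgt f"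
| "wf_term k S (f \<otimes>\<^sub>t g) \<longleftrightarrow> wf_term k S f \<and> wf_term k S g"
| "wf_term k S (f \<odot>\<^sub>t g) \<longleftrightarrow> wf_term k S f \<and> wf_term k S g"

inductive term_eq :: "flavour \<Rightarrow> 'a set \<Rightarrow> 'a arrow_term \<Rightarrow> 'a arrow_term \<Rightarrow> bool"
  for k :: flavour and S :: "'a set" where
  refl: "wf_term k S t \<Longrightarrow> term_eq k S t t"
| sym: "term_eq k S t u \<Longrightarrow> term_eq k S u t"
| trans: "\<lbrakk>term_eq k S t u; term_eq k S u v\<rbrakk> \<Longrightarrow> term_eq k S t v"
| cmp_cong: "\<lbrakk>term_eq k S g g'; term_eq k S f f'; src g = tgt f\<rbrakk>
    \<Longrightarrow> term_eq k S (g \<circ>\<^sub>t f) (g' \<circ>\<^sub>t f')"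
| ten_cong: "\<lbrakk>term_eq k S f f'; term_eq k S g g'\<rbrakk> \<Longrightarrow> term_eq k S (f \<otimes>\<^sub>t g) (f' \<otimes>\<^sub>t g')"
| par_cong: "\<lbrakk>term_eq k S f f'; term_eq k S g g'\<rbrakk> \<Longrightarrow> term_eq k S (f \<odot>\<^sub>t g) (f' \<odot>\<^sub>t g')"
| id_left: "wf_term k S f \<Longrightarrow> term_eq k S (Idt (tgt f) \<circ>\<^sub>t f) f"
| id_right: "wf_term k S f \<Longrightarrow> term_eq k S (f \<circ>\<^sub>t Idt (src f)) f"
| cmp_assoc: "wf_term k S (h \<circ>\<^sub>t g \<circ>\<^sub>t f) \<Longrightarrow> term_eq k S ((h \<circ>\<^sub>t g) \<circ>\<^sub>t f) (h \<circ>\<^sub>t g \<circ>\<^sub>t f)"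
| ten_id: "\<lbrakk>A \<in> exprs S; B \<in> exprs S\<rbrakk> \<Longrightarrow> term_eq k S (Idt A \<otimes>\<^sub>t Idt B) (Idt (A \<otimes>\<^sub>e B))"
| ten_cmp: "\<lbrakk>wf_term k S (f' \<circ>\<^sub>t f); wf_term k S (g' \<circ>\<^sub>t g)\<rbrakk>
    \<Longrightarrow> term_eq k S ((f' \<circ>\<^sub>t f) \<otimes>\<^sub>t (g' \<circ>\<^sub>t g)) ((f' \<otimes>\<^sub>t g') \<circ>\<^sub>t (f \<otimes>\<^sub>t g))"
| par_id: "\<lbrakk>A \<in> exprs S; B \<in> exprs S\<rbrakk> \<Longrightarrow> term_eq k S (Idt A \<odot>\<^sub>t Idt B) (Idt (A \<odot>\<^sub>e B))"
| par_cmp: "\<lbrakk>wf_term k S (f' \<circ>\<^sub>t f); wf_term k S (g' \<circ>\<^sub>t g)\<rbrakk>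
    \<Longrightarrow> term_eq k S ((f' \<circ>\<^sub>t f) \<odot>\<^sub>t (g' \<circ>\<^sub>t g)) ((f' \<odot>\<^sub>t g') \<circ>\<^sub>t (f \<odot>\<^sub>t g))"
| al_nat: "\<lbrakk>wf_term k S f; wf_term k S g; wf_term k S h\<rbrakk>
    \<Longrightarrow> term_eq k S (Al (tgt f) (tgt g) (tgt h) \<circ>\<^sub>t (f \<otimes>\<^sub>t (g \<otimes>\<^sub>t h)))
                   (((f \<otimes>\<^sub>t g) \<otimes>\<^sub>t h) \<circ>\<^sub>t Al (src f) (src g) (src h))"
| be_nat: "\<lbrakk>wf_term k S f; wf_term k S g; wf_term k S h\<rbrakk>
    \<Longrightarrow> term_eq k S (Be (tgt f) (tgt g) (tgt h) \<circ>\<^sub>t (f \<odot>\<^sub>t (g \<odot>\<^sub>t h)))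
                   (((f \<odot>\<^sub>t g) \<odot>\<^sub>t h) \<circ>\<^sub>t Be (src f) (src g) (src h))"
| dl_nat: "\<lbrakk>wf_term k S f; wf_term k S g; wf_term k S h\<rbrakk>
    \<Longrightarrow> term_eq k S (Dl (tgt f) (tgt g) (tgt h) \<circ>\<^sub>t (f \<otimes>\<^sub>t (g \<odot>\<^sub>t h)))
                   (((f \<otimes>\<^sub>t g) \<odot>\<^sub>t h) \<circ>\<^sub>t Dl (src f) (src g) (src h))"
| dr_nat: "\<lbrakk>wf_term k S f; wf_term k S g; wf_term k S h\<rbrakk>
    \<Longrightarrow> term_eq k S (Dr (tgt f) (tgt g) (tgt h) \<circ>\<^sub>t ((f \<odot>\<^sub>t g) \<otimes>\<^sub>t h))
                   ((f \<odot>\<^sub>t (g \<otimes>\<^sub>t h)) \<circ>\<^sub>t Dr (src f) (src g) (src h))"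
| al_inv_left: "\<lbrakk>k = LD; A \<in> exprs S; B \<in> exprs S; C \<in> exprs S\<rbrakk>
    \<Longrightarrow> term_eq k S (AlInv A B C \<circ>\<^sub>t Al A B C) (Idt (A \<otimes>\<^sub>e (B \<otimes>\<^sub>e C)))"
| al_inv_right: "\<lbrakk>k = LD; A \<in> exprs S; B \<in> exprs S; C \<in> exprs S\<rbrakk>
    \<Longrightarrow> term_eq k S (Al A B C \<circ>\<^sub>t AlInv A B C) (Idt ((A \<otimes>\<^sub>e B) \<otimes>\<^sub>e C))"
| be_inv_left: "\<lbrakk>k = LD; A \<in> exprs S; B \<in> exprs S; C \<in> exprs S\<rbrakk>
    \<Longrightarrow> term_eq k S (BeInv A B C \<circ>\<^sub>t Be A B C) (Idt (A \<odot>\<^sub>e (B \<odot>\<^sub>e C)))"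
| be_inv_right: "\<lbrakk>k = LD; A \<in> exprs S; B \<in> exprs S; C \<in> exprs S\<rbrakk>
    \<Longrightarrow> term_eq k S (Be A B C \<circ>\<^sub>t BeInv A B C) (Idt ((A \<odot>\<^sub>e B) \<odot>\<^sub>e C))"
| p1: "\<lbrakk>A \<in> exprs S; B \<in> exprs S; C \<in> exprs S; D \<in> exprs S\<rbrakk> \<Longrightarrow> term_eq k S
    (Al (A \<otimes>\<^sub>e B) C D \<circ>\<^sub>t Al A B (C \<otimes>\<^sub>e D))
    ((Al A B C \<otimes>\<^sub>t Idt D) \<circ>\<^sub>t Al A (B \<otimes>\<^sub>e C) D \<circ>\<^sub>t (Idt A \<otimes>\<^sub>t Al B C D))"
| p2: "\<lbrakk>A \<in> exprs S; B \<in> exprs S; C \<in> exprs S; D \<in> exprs S\<rbrakk> \<Longrightarrow> term_eq k S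
    (Dl (A \<otimes>\<^sub>e B) C D \<circ>\<^sub>t Al A B (C \<odot>\<^sub>e D))
    ((Al A B C \<odot>\<^sub>t Idt D) \<circ>\<^sub>t Dl A (B \<otimes>\<^sub>e C) D \<circ>\<^sub>t (Idt A \<otimes>\<^sub>t Dl B C D))"
| p3: "\<lbrakk>A \<in> exprs S; B \<in> exprs S; C \<in> exprs S; D \<in> exprs S\<rbrakk> \<Longrightarrow> term_eq k S
    (Dl A B (C \<otimes>\<^sub>e D) \<circ>\<^sub>t (Idt A \<otimes>\<^sub>t Dr B C D))
    (Dr (A \<otimes>\<^sub>e B) C D \<circ>\<^sub>t (Dl A B C \<otimes>\<^sub>t Idt D) \<circ>\<^sub>t Al A (B \<odot>\<^sub>e C) D)"
| p4: "\<lbrakk>A \<in> exprs S; B \<in> exprs S; C \<in> exprs S; D \<in> exprs S\<rbrakk> \<Longrightarrow> term_eq k S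
    (Be (A \<otimes>\<^sub>e B) C D \<circ>\<^sub>t Dl A B (C \<odot>\<^sub>e D))
    ((Dl A B C \<odot>\<^sub>t Idt D) \<circ>\<^sub>t Dl A (B \<odot>\<^sub>e C) D \<circ>\<^sub>t (Idt A \<otimes>\<^sub>t Be B C D))"
| p5: "\<lbrakk>A \<in> exprs S; B \<in> exprs S; C \<in> exprs S; D \<in> exprs S\<rbrakk> \<Longrightarrow> term_eq k S
    ((Idt A \<odot>\<^sub>t Al B C D) \<circ>\<^sub>t Dr A B (C \<otimes>\<^sub>e D))
    (Dr A (B \<otimes>\<^sub>e C) D \<circ>\<^sub>t (Dr A B C \<otimes>\<^sub>t Idt D) \<circ>\<^sub>t Al (A \<odot>\<^sub>e B) C D)"
| p6: "\<lbrakk>A \<in> exprs S; B \<in> exprs S; C \<in> exprs S; D \<in> exprs S\<rbrakk> \<Longrightarrow> term_eq k S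
    ((Dr A B C \<odot>\<^sub>t Idt D) \<circ>\<^sub>t Dl (A \<odot>\<^sub>e B) C D)
    (Be A (B \<otimes>\<^sub>e C) D \<circ>\<^sub>t (Idt A \<odot>\<^sub>t Dl B C D) \<circ>\<^sub>t Dr A B (C \<odot>\<^sub>e D))"
| p7: "\<lbrakk>A \<in> exprs S; B \<in> exprs S; C \<in> exprs S; D \<in> exprs S\<rbrakk> \<Longrightarrow> term_eq k S
    (Dr (A \<odot>\<^sub>e B) C D \<circ>\<^sub>t (Be A B C \<otimes>\<^sub>t Idt D))
    (Be A B (C \<otimes>\<^sub>e D) \<circ>\<^sub>t (Idt A \<odot>\<^sub>t Dr B C D) \<circ>\<^sub>t Dr A (B \<odot>\<^sub>e C) D)"
| p8: "\<lbrakk>A \<in> exprs S; B \<in> exprs S; C \<in> exprs S; D \<in> exprs S\<rbrakk> \<Longrightarrow> term_eq k S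
    (Be (A \<odot>\<^sub>e B) C D \<circ>\<^sub>t Be A B (C \<odot>\<^sub>e D))
    ((Be A B C \<odot>\<^sub>t Idt D) \<circ>\<^sub>t Be A (B \<odot>\<^sub>e C) D \<circ>\<^sub>t (Idt A \<odot>\<^sub>t Be B C D))"

definition cls :: "flavour \<Rightarrow> 'a set \<Rightarrow> 'a arrow_term \<Rightarrow> 'a arrow_term set" where
  "cls k S t = {u. term_eq k S t u}"

definition rep :: "'a arrow_term set \<Rightarrow> 'a arrow_term" where
  "rep X = (SOME t. t \<in> X)"

text \<open>Operations on classes go through representatives; independence of the choice is
  \<open>free_simps\<close> below.\<close>

definition free :: "flavour \<Rightarrow> 'a set \<Rightarrow> ('a expr, 'a arrow_term set) ld_structure" where
  "free k S = \<lparr>Ob = exprs S, Ar = cls k S ` {t. wf_term k S t},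
     dom = (\<lambda>X. src (rep X)), cod = (\<lambda>X. tgt (rep X)),
     ident = (\<lambda>A. cls k S (Idt A)),
     comp = (\<lambda>Y X. cls k S (rep Y \<circ>\<^sub>t rep X)),
     tenO = Ten, tenA = (\<lambda>X Y. cls k S (rep X \<otimes>\<^sub>t rep Y)),
     parO = Par, parA = (\<lambda>X Y. cls k S (rep X \<odot>\<^sub>t rep Y)),
     assoc_ten = (\<lambda>A B C. cls k S (Al A B C)),
     assoc_par = (\<lambda>A B C. cls k S (Be A B C)),
     dist_l = (\<lambda>A B C. cls k S (Dl A B C)),
     dist_r = (\<lambda>A B C. cls k S (Dr A B C))\<rparr>"

abbreviation free_ld :: "'a set \<Rightarrow> ('a expr, 'a arrow_term set) ld_structure" where
  "free_ld S \<equiv> free LD S"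

abbreviation free_lax_ld :: "'a set \<Rightarrow> ('a expr, 'a arrow_term set) ld_structure" where
  "free_lax_ld S \<equiv> free Lax S"

text \<open>The strict functor out of the free category induced by a map \<open>\<phi>\<close> on generators.\<close>

primrec evalO :: "('o, 'm, 'z) ld_structure_scheme \<Rightarrow> ('a \<Rightarrow> 'o) \<Rightarrow> 'a expr \<Rightarrow> 'o" where
  "evalO \<C> \<phi> (Gen a) = \<phi> a"
| "evalO \<C> \<phi> (A \<otimes>\<^sub>e B) = tenO \<C> (evalO \<C> \<phi> A) (evalO \<C> \<phi> B)"
| "evalO \<C> \<phi> (A \<odot>\<^sub>e B) = parO \<C> (evalO \<C> \<phi> A) (evalO \<C> \<phi> B)"

primrec evalA :: "('o, 'm, 'z) ld_structure_scheme \<Rightarrow> ('a \<Rightarrow> 'o) \<Rightarrow> 'a arrow_term \<Rightarrow> 'm" where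
  "evalA \<C> \<phi> (Idt A) = ident \<C> (evalO \<C> \<phi> A)"
| "evalA \<C> \<phi> (Al A B C) = assoc_ten \<C> (evalO \<C> \<phi> A) (evalO \<C> \<phi> B) (evalO \<C> \<phi> C)"
| "evalA \<C> \<phi> (AlInv A B C) =
     inv_arrow \<C> (assoc_ten \<C> (evalO \<C> \<phi> A) (evalO \<C> \<phi> B) (evalO \<C> \<phi> C))"
| "evalA \<C> \<phi> (Be A B C) = assoc_par \<C> (evalO \<C> \<phi> A) (evalO \<C> \<phi> B) (evalO \<C> \<phi> C)"
| "evalA \<C> \<phi> (BeInv A B C) =
     inv_arrow \<C> (assoc_par \<C> (evalO \<C> \<phi> A) (evalO \<C> \<phi> B) (evalO \<C> \<phi> C))"
| "evalA \<C> \<phi> (Dl A B C) = dist_l \<C> (evalO \<C> \<phi> A) (evalO \<C> \<phi> B) (evalO \<C> \<phi> C)"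
| "evalA \<C> \<phi> (Dr A B C) = dist_r \<C> (evalO \<C> \<phi> A) (evalO \<C> \<phi> B) (evalO \<C> \<phi> C)"
| "evalA \<C> \<phi> (g \<circ>\<^sub>t f) = comp \<C> (evalA \<C> \<phi> g) (evalA \<C> \<phi> f)"
| "evalA \<C> \<phi> (f \<otimes>\<^sub>t g) = tenA \<C> (evalA \<C> \<phi> f) (evalA \<C> \<phi> g)"
| "evalA \<C> \<phi> (f \<odot>\<^sub>t g) = parA \<C> (evalA \<C> \<phi> f) (evalA \<C> \<phi> g)"

definition free_lift :: "('o, 'm, 'z) ld_structure_scheme \<Rightarrow> ('a \<Rightarrow> 'o)
    \<Rightarrow> ('a expr, 'a arrow_term set, 'o, 'm) fctr" where
  "free_lift \<C> \<phi> = \<lparr>onO = evalO \<C> \<phi>, onA = (\<lambda>X. evalA \<C> \<phi> (rep X))\<rparr>"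

definition counit :: "('o, 'm, 'z) ld_structure_scheme
    \<Rightarrow> ('o expr, 'o arrow_term set, 'o, 'm) fctr" where
  "counit \<C> = free_lift \<C> (\<lambda>A. A)"

definition formal_diagram :: "flavour \<Rightarrow> ('j, 'k, 'y) category_scheme
    \<Rightarrow> ('o, 'm, 'z) ld_structure_scheme \<Rightarrow> ('j, 'k, 'o, 'm) fctr \<Rightarrow> bool" where
  "formal_diagram k \<J> \<C> D \<longleftrightarrow> is_functor \<J> \<C> D \<and>
     (\<exists>D'. is_functor \<J> (free k (Ob \<C>)) D' \<and>
        eq_functor_on \<J> D (comp_functor (counit \<C>) D'))"

lemma exprs_simps [simp]:
  "Gen a \<in> exprs S \<longleftrightarrow> a \<in> S"
  "A \<otimes>\<^sub>e B \<in> exprs S \<longleftrightarrow> A \<in> exprs S \<and> B \<in> exprs S"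
  "A \<odot>\<^sub>e B \<in> exprs S \<longleftrightarrow> A \<in> exprs S \<and> B \<in> exprs S"
  by (auto simp: exprs_def)

lemma wf_src_tgt: "wf_term k S t \<Longrightarrow> src t \<in> exprs S \<and> tgt t \<in> exprs S"
  by (induction t) auto

lemma term_eq_wf:
  "term_eq k S t u \<Longrightarrow> wf_term k S t \<and> wf_term k S u \<and> src t = src u \<and> tgt t = tgt u"
  by (induction rule: term_eq.induct) (auto dest: wf_src_tgt)

lemma cls_eq: "term_eq k S t u \<Longrightarrow> cls k S t = cls k S u"
  unfolding cls_def by (auto intro: term_eq.sym term_eq.trans)

lemma cls_eq_iff: "wf_term k S t \<Longrightarrow> cls k S t = cls k S u \<longleftrightarrow> term_eq k S t u"
  using cls_eq[of k S t u] term_eq.refl[of k S t] unfolding cls_def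
  by (auto intro: term_eq.sym)

lemma rep_cls: "wf_term k S t \<Longrightarrow> term_eq k S t (rep (cls k S t))"
  unfolding rep_def cls_def by (simp, rule someI, rule term_eq.refl)

lemma free_carriers [simp]:
  "Ob (free k S) = exprs S"
  "Ar (free k S) = cls k S ` {t. wf_term k S t}"
  "ident (free k S) A = cls k S (Idt A)"
  "tenO (free k S) = Ten"
  "parO (free k S) = Par"
  "assoc_ten (free k S) A B C = cls k S (Al A B C)"
  "assoc_par (free k S) A B C = cls k S (Be A B C)"
  "dist_l (free k S) A B C = cls k S (Dl A B C)"
  "dist_r (free k S) A B C = cls k S (Dr A B C)"
  by (simp_all add: free_def)

lemma free_simps:
  assumes "wf_term k S t"
  shows "dom (free k S) (cls k S t) = src t"
    and "cod (free k S) (cls k S t) = tgt t"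
    and "wf_term k S u \<Longrightarrow> src u = tgt t \<Longrightarrow>
      comp (free k S) (cls k S u) (cls k S t) = cls k S (u \<circ>\<^sub>t t)"
    and "wf_term k S u \<Longrightarrow> tenA (free k S) (cls k S t) (cls k S u) = cls k S (t \<otimes>\<^sub>t u)"
    and "wf_term k S u \<Longrightarrow> parA (free k S) (cls k S t) (cls k S u) = cls k S (t \<odot>\<^sub>t u)"
proof -
  note r = rep_cls[OF assms]
  show "dom (free k S) (cls k S t) = src t" "cod (free k S) (cls k S t) = tgt t"
    using term_eq_wf[OF r] by (simp_all add: free_def)
  { assume u: "wf_term k S u"
    note r' = rep_cls[OF u]
    { assume "src u = tgt t"
      then show "comp (free k S) (cls k S u) (cls k S t) = cls k S (u \<circ>\<^sub>t t)"
        using term_eq.cmp_cong[OF r' r] by (simp add: free_def cls_eq) }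
    show "tenA (free k S) (cls k S t) (cls k S u) = cls k S (t \<otimes>\<^sub>t u)"
      using term_eq.ten_cong[OF r r'] by (simp add: free_def cls_eq)
    show "parA (free k S) (cls k S t) (cls k S u) = cls k S (t \<odot>\<^sub>t u)"
      using term_eq.par_cong[OF r r'] by (simp add: free_def cls_eq) }
qed

lemma free_hom:
  "X \<in> hom (free k S) A B \<longleftrightarrow> (\<exists>t. X = cls k S t \<and> wf_term k S t \<and> src t = A \<and> tgt t = B)"
  unfolding hom_def by (auto simp: free_simps)

lemma free_homE:
  assumes "X \<in> hom (free k S) A B"
  obtains t where "X = cls k S t" "wf_term k S t" "A = src t" "B = tgt t"
  using assms by (auto simp: free_hom)

lemma free_homI: "\<lbrakk>wf_term k S t; src t = A; tgt t = B\<rbrakk> \<Longrightarrow> cls k S t \<in> hom (free k S) A B"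
  by (auto simp: free_hom)

lemmas term_eq_axioms =
  term_eq.id_left term_eq.id_right term_eq.cmp_assoc term_eq.ten_id term_eq.ten_cmp
  term_eq.par_id term_eq.par_cmp term_eq.al_nat term_eq.be_nat term_eq.dl_nat
  term_eq.dr_nat term_eq.al_inv_left term_eq.al_inv_right term_eq.be_inv_left
  term_eq.be_inv_right term_eq.p1 term_eq.p2 term_eq.p3 term_eq.p4 term_eq.p5 term_eq.p6
  term_eq.p7 term_eq.p8

theorem free_is_lax_ld: "lax_ld_category (free k S)"
  by unfold_locales
    (auto simp: free_simps wf_src_tgt elim!: free_homE del: equalityI
      intro!: free_homI cls_eq term_eq_axioms)

theorem free_is_ld: "ld_category (free_ld S)"
proof -
  interpret lax_ld_category "free_ld S" by (rule free_is_lax_ld)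
  show ?thesis
  proof unfold_locales
    fix A B C assume *: "A \<in> Ob (free_ld S)" "B \<in> Ob (free_ld S)" "C \<in> Ob (free_ld S)"
    then have "inverse_arrows (free_ld S) (cls LD S (Al A B C)) (cls LD S (AlInv A B C))"
      "inverse_arrows (free_ld S) (cls LD S (Be A B C)) (cls LD S (BeInv A B C))"
      by (auto simp: inverse_arrows_def free_simps intro!: free_homI cls_eq term_eq_axioms)
    then show "iso_arrow (free_ld S) (assoc_ten (free_ld S) A B C)"
      "iso_arrow (free_ld S) (assoc_par (free_ld S) A B C)"
      by (auto simp: iso_arrow_def)
  qed
qed

lemma (in category) inv_arrow:
  assumes "iso_arrow \<C> f" shows "inverse_arrows \<C> f (inv_arrow \<C> f)"
proof -
  have "g = h" if "inverse_arrows \<C> f g" "inverse_arrows \<C> f h" for g h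
  proof -
    have f: "f \<in> hom \<C> (dom \<C> f) (cod \<C> f)" and g: "g \<in> hom \<C> (cod \<C> f) (dom \<C> f)"
      and h: "h \<in> hom \<C> (cod \<C> f) (dom \<C> f)"
      using that by (auto simp: inverse_arrows_def hom_def)
    have "g = g \<cdot> (f \<cdot> h)" using that ident_right[OF g] by (simp add: inverse_arrows_def)
    also have "\<dots> = (g \<cdot> f) \<cdot> h" using comp_assoc[OF h f g] by simp
    also have "\<dots> = h" using that ident_left[OF h] by (simp add: inverse_arrows_def)
    finally show ?thesis .
  qed
  then show ?thesis
    using assms unfolding iso_arrow_def inv_arrow_def by (metis theI)
qed

text \<open>The common hypothesis on the target of a lift, for both flavours.\<close>

definition ld_model :: "flavour \<Rightarrow> ('o, 'm, 'z) ld_structure_scheme \<Rightarrow> bool" where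
  "ld_model k \<C> \<longleftrightarrow> lax_ld_category \<C> \<and> (k = LD \<longrightarrow> ld_category \<C>)"

context
  fixes k :: flavour and \<C> :: "('o, 'm, 'z) ld_structure_scheme" (structure)
    and S :: "'a set" and \<phi> :: "'a \<Rightarrow> 'o"
  assumes model: "ld_model k \<C>" and phi: "\<And>a. a \<in> S \<Longrightarrow> \<phi> a \<in> Ob \<C>"
begin

interpretation lax_ld_category \<C> using model by (simp add: ld_model_def)

lemma evalO_in: "A \<in> exprs S \<Longrightarrow> evalO \<C> \<phi> A \<in> Ob \<C>"
  by (induction A) (auto simp: phi ten_ob par_ob)

lemma inverses:
  assumes "k = LD" "A \<in> Ob \<C>" "B \<in> Ob \<C>" "C \<in> Ob \<C>"
  shows "inverse_arrows \<C> (\<alpha> A B C) (inv_arrow \<C> (\<alpha> A B C))"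
    and "inverse_arrows \<C> (\<beta> A B C) (inv_arrow \<C> (\<beta> A B C))"
proof -
  interpret ld_category \<C> using model assms by (simp add: ld_model_def)
  show "inverse_arrows \<C> (\<alpha> A B C) (inv_arrow \<C> (\<alpha> A B C))"
    "inverse_arrows \<C> (\<beta> A B C) (inv_arrow \<C> (\<beta> A B C))"
    using assms by (auto intro: inv_arrow assoc_ten_iso assoc_par_iso)
qed

lemma inverses':
  assumes "k = LD" "A \<in> Ob \<C>" "B \<in> Ob \<C>" "C \<in> Ob \<C>"
  shows "inv_arrow \<C> (\<alpha> A B C) \<in> hom \<C> ((A \<otimes> B) \<otimes> C) (A \<otimes> (B \<otimes> C))"
    and "inv_arrow \<C> (\<alpha> A B C) \<cdot> \<alpha> A B C = \<one> (A \<otimes> (B \<otimes> C))"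
    and "\<alpha> A B C \<cdot> inv_arrow \<C> (\<alpha> A B C) = \<one> ((A \<otimes> B) \<otimes> C)"
    and "inv_arrow \<C> (\<beta> A B C) \<in> hom \<C> ((A \<odot> B) \<odot> C) (A \<odot> (B \<odot> C))"
    and "inv_arrow \<C> (\<beta> A B C) \<cdot> \<beta> A B C = \<one> (A \<odot> (B \<odot> C))"
    and "\<beta> A B C \<cdot> inv_arrow \<C> (\<beta> A B C) = \<one> ((A \<odot> B) \<odot> C)"
  using inverses[OF assms] assoc_ten_hom[OF assms(2-4)] assoc_par_hom[OF assms(2-4)]
  by (auto simp: inverse_arrows_def hom_def)

lemma evalA_hom:
  "wf_term k S t \<Longrightarrow> evalA \<C> \<phi> t \<in> hom \<C> (evalO \<C> \<phi> (src t)) (evalO \<C> \<phi> (tgt t))"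
proof (induction t)
  case (Cmp t u) then show ?case by (auto intro: comp_hom)
qed (auto intro: evalO_in ident_hom assoc_ten_hom assoc_par_hom dist_l_hom dist_r_hom
      ten_hom par_hom inverses')

lemma evalA_term_eq: "term_eq k S t u \<Longrightarrow> evalA \<C> \<phi> t = evalA \<C> \<phi> u"
proof (induction rule: term_eq.induct)
  case (id_left f) then show ?case by (simp add: ident_left[OF evalA_hom])
next
  case (id_right f) then show ?case by (simp add: ident_right[OF evalA_hom])
next
  case (cmp_assoc h g f)
  then have "evalA \<C> \<phi> f \<in> hom \<C> (evalO \<C> \<phi> (src f)) (evalO \<C> \<phi> (tgt f))"
    "evalA \<C> \<phi> g \<in> hom \<C> (evalO \<C> \<phi> (tgt f)) (evalO \<C> \<phi> (tgt g))"
    "evalA \<C> \<phi> h \<in> hom \<C> (evalO \<C> \<phi> (tgt g)) (evalO \<C> \<phi> (tgt h))"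
    using evalA_hom[of f] evalA_hom[of g] evalA_hom[of h] by auto
  then show ?case by (simp add: comp_assoc)
next
  case (ten_cmp f' f g' g)
  then have "evalA \<C> \<phi> f' \<in> hom \<C> (evalO \<C> \<phi> (tgt f)) (evalO \<C> \<phi> (tgt f'))"
    "evalA \<C> \<phi> g' \<in> hom \<C> (evalO \<C> \<phi> (tgt g)) (evalO \<C> \<phi> (tgt g'))"
    using evalA_hom[of f'] evalA_hom[of g'] by auto
  then show ?case using ten_cmp by (auto intro: ten_comp evalA_hom)
next
  case (par_cmp f' f g' g)
  then have "evalA \<C> \<phi> f' \<in> hom \<C> (evalO \<C> \<phi> (tgt f)) (evalO \<C> \<phi> (tgt f'))"
    "evalA \<C> \<phi> g' \<in> hom \<C> (evalO \<C> \<phi> (tgt g)) (evalO \<C> \<phi> (tgt g'))"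
    using evalA_hom[of f'] evalA_hom[of g'] by auto
  then show ?case using par_cmp by (auto intro: par_comp evalA_hom)
next
  case (al_nat f g h) then show ?case by (simp add: assoc_ten_nat evalA_hom)
next
  case (be_nat f g h) then show ?case by (simp add: assoc_par_nat evalA_hom)
next
  case (dl_nat f g h) then show ?case by (simp add: dist_l_nat evalA_hom)
next
  case (dr_nat f g h) then show ?case by (simp add: dist_r_nat evalA_hom)
qed (simp_all add: evalO_in ten_ident par_ident inverses' P1 P2 P3 P4 P5 P6 P7 P8)

lemma free_lift_cls: "wf_term k S t \<Longrightarrow> onA (free_lift \<C> \<phi>) (cls k S t) = evalA \<C> \<phi> t"
  using evalA_term_eq[OF rep_cls] by (simp add: free_lift_def)

theorem free_lift_strict: "strict_ld_functor (free k S) \<C> (free_lift \<C> \<phi>)"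
proof -
  have o: "onO (free_lift \<C> \<phi>) = evalO \<C> \<phi>" by (simp add: free_lift_def)
  show ?thesis
    unfolding strict_ld_functor_def is_functor_def o
    by (auto simp: free_simps free_lift_cls evalO_in evalA_hom elim!: free_homE)
qed

theorem free_lift_unique:
  assumes F: "strict_ld_functor (free k S) \<C> F" and gen: "\<And>a. a \<in> S \<Longrightarrow> onO F (Gen a) = \<phi> a"
  shows "eq_functor_on (free k S) F (free_lift \<C> \<phi>)"
proof -
  have fo: "onO F A = evalO \<C> \<phi> A" if "A \<in> exprs S" for A
    using that F by (induction A) (auto simp: gen strict_ld_functor_def)
  have id: "onA F (cls k S (Idt A)) = \<one> (evalO \<C> \<phi> A)" if "A \<in> exprs S" for A
    using F that fo by (auto simp: strict_ld_functor_def is_functor_def)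
  have cmp: "onA F (cls k S (g \<circ>\<^sub>t f)) = onA F (cls k S g) \<cdot> onA F (cls k S f)"
    if "wf_term k S (g \<circ>\<^sub>t f)" for f g
  proof -
    have "onA F (comp (free k S) (cls k S g) (cls k S f)) = onA F (cls k S g) \<cdot> onA F (cls k S f)"
      using F that by (auto simp: strict_ld_functor_def is_functor_def free_simps)
    then show ?thesis using that by (simp add: free_simps)
  qed
  have hm: "onA F (cls k S f) \<in> hom \<C> (evalO \<C> \<phi> (src f)) (evalO \<C> \<phi> (tgt f))"
    if "wf_term k S f" for f
  proof -
    have "cls k S f \<in> hom (free k S) (src f) (tgt f)"
      using that by (auto intro: free_homI)
    then have "onA F (cls k S f) \<in> hom \<C> (onO F (src f)) (onO F (tgt f))"
      using F wf_src_tgt[OF that] by (simp add: strict_ld_functor_def is_functor_def)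
    then show ?thesis using fo wf_src_tgt[OF that] by simp
  qed
  have inv: "onA F (cls k S g) = inv_arrow \<C> (onA F (cls k S f))"
    if "wf_term k S f" "wf_term k S g" "src f = tgt g" "src g = tgt f"
      "iso_arrow \<C> (onA F (cls k S f))"
      "term_eq k S (g \<circ>\<^sub>t f) (Idt (src f))" "term_eq k S (f \<circ>\<^sub>t g) (Idt (tgt f))" for f g
  proof -
    let ?f = "onA F (cls k S f)" and ?g = "onA F (cls k S g)" and ?i = "inv_arrow \<C> (onA F (cls k S f))"
    have i: "inverse_arrows \<C> ?f ?i" by (rule inv_arrow[OF that(5)])
    have f: "?f \<in> hom \<C> (evalO \<C> \<phi> (src f)) (evalO \<C> \<phi> (tgt f))"
      and g: "?g \<in> hom \<C> (evalO \<C> \<phi> (tgt f)) (evalO \<C> \<phi> (src f))"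
      using hm[of f] hm[of g] that by auto
    have ih: "?i \<in> hom \<C> (evalO \<C> \<phi> (tgt f)) (evalO \<C> \<phi> (src f))"
      and fi: "?f \<cdot> ?i = \<one> (evalO \<C> \<phi> (tgt f))"
      using i f by (auto simp: inverse_arrows_def hom_def)
    have gf: "?g \<cdot> ?f = \<one> (evalO \<C> \<phi> (src f))"
      using cmp[of g f] id[of "src f"] that wf_src_tgt[of k S f] by (simp add: cls_eq)
    have "?g = ?g \<cdot> (?f \<cdot> ?i)" using fi ident_right[OF g] by simp
    also have "\<dots> = (?g \<cdot> ?f) \<cdot> ?i" using comp_assoc[OF ih f g] by simp
    also have "\<dots> = ?i" using gf ident_left[OF ih] by simp
    finally show ?thesis .
  qed
  have al: "onA F (cls k S (Al A B C)) = \<alpha> (evalO \<C> \<phi> A) (evalO \<C> \<phi> B) (evalO \<C> \<phi> C)"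
    and be: "onA F (cls k S (Be A B C)) = \<beta> (evalO \<C> \<phi> A) (evalO \<C> \<phi> B) (evalO \<C> \<phi> C)"
    and dl: "onA F (cls k S (Dl A B C)) = \<delta>\<^sup>l (evalO \<C> \<phi> A) (evalO \<C> \<phi> B) (evalO \<C> \<phi> C)"
    and dr: "onA F (cls k S (Dr A B C)) = \<delta>\<^sup>r (evalO \<C> \<phi> A) (evalO \<C> \<phi> B) (evalO \<C> \<phi> C)"
    if "A \<in> exprs S" "B \<in> exprs S" "C \<in> exprs S" for A B C
    using F that fo by (auto simp: strict_ld_functor_def)
  have ten: "onA F (cls k S (f \<otimes>\<^sub>t g)) = onA F (cls k S f) \<otimes>\<^sub>a onA F (cls k S g)"
    and par: "onA F (cls k S (f \<odot>\<^sub>t g)) = onA F (cls k S f) \<odot>\<^sub>a onA F (cls k S g)"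
    if "wf_term k S f" "wf_term k S g" for f g
  proof -
    have "cls k S f \<in> Ar (free k S)" "cls k S g \<in> Ar (free k S)" using that by auto
    then have "onA F (tenA (free k S) (cls k S f) (cls k S g)) = onA F (cls k S f) \<otimes>\<^sub>a onA F (cls k S g)"
      "onA F (parA (free k S) (cls k S f) (cls k S g)) = onA F (cls k S f) \<odot>\<^sub>a onA F (cls k S g)"
      using F unfolding strict_ld_functor_def by blast+
    then show "onA F (cls k S (f \<otimes>\<^sub>t g)) = onA F (cls k S f) \<otimes>\<^sub>a onA F (cls k S g)"
      "onA F (cls k S (f \<odot>\<^sub>t g)) = onA F (cls k S f) \<odot>\<^sub>a onA F (cls k S g)"
      using that by (simp_all add: free_simps)
  qed
  have "onA F (cls k S t) = evalA \<C> \<phi> t" if "wf_term k S t" for t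
    using that
  proof (induction t)
    case (AlInv A B C)
    then have "iso_arrow \<C> (\<alpha> (evalO \<C> \<phi> A) (evalO \<C> \<phi> B) (evalO \<C> \<phi> C))"
      unfolding iso_arrow_def by (auto intro!: exI inverses(1) evalO_in)
    then show ?case using AlInv al[of A B C]
      by (subst inv[of "Al A B C"]) (auto intro: term_eq_axioms)
  next
    case (BeInv A B C)
    then have "iso_arrow \<C> (\<beta> (evalO \<C> \<phi> A) (evalO \<C> \<phi> B) (evalO \<C> \<phi> C))"
      unfolding iso_arrow_def by (auto intro!: exI inverses(2) evalO_in)
    then show ?case using BeInv be[of A B C]
      by (subst inv[of "Be A B C"]) (auto intro: term_eq_axioms)
  next
    case (Cmp t u) then show ?case using cmp[of t u] by simp
  qed (simp_all add: id al be dl dr ten par)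
  then show ?thesis
    by (auto simp: eq_functor_on_def fo free_lift_cls) (simp add: free_lift_def)
qed

end

end

(*
Call a par node of an expression A cuttable if A has a
canonical arrow c : A -> L par R bringing that node to the root. In the non-lax flavour every par
node is cuttable; in the lax one it must not lie below the left argument of another par, as only
the inverse associator could lift it from there. Cuts are natural: for an arrow f : A -> A', a
cut c' of A' restricts to a cut c of A with c' f = (f1 par f2) c, each generator being settled by
one naturality square and one of (P1)-(P8). Taking for c' the root of a target A' = B par B', an
arrow f : A -> B par B' is determined by the pair f1 : L -> B, f2 : R -> B' between smaller
expressions. Reversing arrows, arguments and the two products turns sources A tensor A' into
targets of that form. As the source of an arrow being a par forces its target to be one, the only
remaining arrows go from a generator to itself, and these are identities.
*)

theory Submission
  imports Defs
begin

section \<open>Calculating in lax linearly distributive categories\<close>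

context category
begin

lemma homI: "\<lbrakk>f \<in> Ar \<C>; dom \<C> f = A; cod \<C> f = B\<rbrakk> \<Longrightarrow> f \<in> hom \<C> A B"
  by (simp add: hom_def)

lemma hom_iff: "f \<in> hom \<C> A B \<longleftrightarrow>
    f \<in> Ar \<C> \<and> dom \<C> f = A \<and> cod \<C> f = B \<and> A \<in> Ob \<C> \<and> B \<in> Ob \<C>"
  using dom_in cod_in by (auto simp: hom_def)

lemma ident_simps:
  assumes "A \<in> Ob \<C>"
  shows "\<one> A \<in> Ar \<C>" "dom \<C> (\<one> A) = A" "cod \<C> (\<one> A) = A"
  using ident_hom[OF assms] by (simp_all add: hom_def)

lemma comp_simps:
  assumes "f \<in> Ar \<C>" "g \<in> Ar \<C>" "dom \<C> g = cod \<C> f"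
  shows "g \<cdot> f \<in> Ar \<C>" "dom \<C> (g \<cdot> f) = dom \<C> f" "cod \<C> (g \<cdot> f) = cod \<C> g"
  using comp_hom[OF homI homI, OF assms(1) HOL.refl HOL.refl assms(2,3) HOL.refl]
  by (simp_all add: hom_def)

lemma ident_comp:
  "\<lbrakk>f \<in> Ar \<C>; cod \<C> f = B\<rbrakk> \<Longrightarrow> \<one> B \<cdot> f = f"
  "\<lbrakk>f \<in> Ar \<C>; dom \<C> f = A\<rbrakk> \<Longrightarrow> f \<cdot> \<one> A = f"
  by (auto intro: ident_left ident_right homI)

lemma comp_assoc':
  "\<lbrakk>f \<in> Ar \<C>; g \<in> Ar \<C>; h \<in> Ar \<C>; dom \<C> g = cod \<C> f; dom \<C> h = cod \<C> g\<rbrakk>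
    \<Longrightarrow> (h \<cdot> g) \<cdot> f = h \<cdot> (g \<cdot> f)"
  by (rule comp_assoc) (auto intro: homI)

lemmas cat_simps = hom_iff ident_simps comp_simps ident_comp comp_assoc' dom_in cod_in

text \<open>Composites are normalised to right-nested form, where an equation for
  \<open>g \<cdot> f\<close> no longer matches once a further arrow follows on the right. This rule
  and the next prolong such equations by an arbitrary \<open>x\<close>.\<close>

lemma comp_extend2:
  "\<lbrakk>g \<cdot> f = y; x \<in> Ar \<C>; f \<in> Ar \<C>; g \<in> Ar \<C>; dom \<C> f = cod \<C> x; dom \<C> g = cod \<C> f\<rbrakk>
    \<Longrightarrow> g \<cdot> (f \<cdot> x) = y \<cdot> x"
  by (auto simp: cat_simps)

lemma comp_extend3:
  "\<lbrakk>h \<cdot> g \<cdot> f = y; x \<in> Ar \<C>; f \<in> Ar \<C>; g \<in> Ar \<C>; h \<in> Ar \<C>;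
    dom \<C> f = cod \<C> x; dom \<C> g = cod \<C> f; dom \<C> h = cod \<C> g\<rbrakk>
    \<Longrightarrow> h \<cdot> (g \<cdot> (f \<cdot> x)) = y \<cdot> x"
  by (auto simp: cat_simps)

text \<open>Moves \<open>u\<close> to the other side of an equation; an axiom containing an
  associator is thus turned into one containing its inverse.\<close>

lemma eq_comp_right_inverse:
  "\<lbrakk>l \<cdot> u = m; u \<cdot> v = \<one> (dom \<C> l); l \<in> Ar \<C>; u \<in> Ar \<C>; v \<in> Ar \<C>;
    dom \<C> l = cod \<C> u; dom \<C> u = cod \<C> v\<rbrakk> \<Longrightarrow> l = m \<cdot> v"
  by (auto simp: cat_simps)

end

context lax_ld_category
begin

lemma ten_simps:
  assumes "f \<in> Ar \<C>" "g \<in> Ar \<C>"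
  shows "f \<otimes>\<^sub>a g \<in> Ar \<C>" "dom \<C> (f \<otimes>\<^sub>a g) = dom \<C> f \<otimes> dom \<C> g" "cod \<C> (f \<otimes>\<^sub>a g) = cod \<C> f \<otimes> cod \<C> g"
  using ten_hom[OF homI homI, OF assms(1) HOL.refl HOL.refl assms(2) HOL.refl HOL.refl]
  by (simp_all add: hom_def)

lemma par_simps:
  assumes "f \<in> Ar \<C>" "g \<in> Ar \<C>"
  shows "f \<odot>\<^sub>a g \<in> Ar \<C>" "dom \<C> (f \<odot>\<^sub>a g) = dom \<C> f \<odot> dom \<C> g" "cod \<C> (f \<odot>\<^sub>a g) = cod \<C> f \<odot> cod \<C> g"
  using par_hom[OF homI homI, OF assms(1) HOL.refl HOL.refl assms(2) HOL.refl HOL.refl]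
  by (simp_all add: hom_def)

lemma ten_whisker:
  "\<lbrakk>f \<in> Ar \<C>; g \<in> Ar \<C>; dom \<C> g = cod \<C> f; B \<in> Ob \<C>\<rbrakk>
    \<Longrightarrow> (g \<cdot> f) \<otimes>\<^sub>a \<one> B = (g \<otimes>\<^sub>a \<one> B) \<cdot> (f \<otimes>\<^sub>a \<one> B)"
  "\<lbrakk>f \<in> Ar \<C>; g \<in> Ar \<C>; dom \<C> g = cod \<C> f; B \<in> Ob \<C>\<rbrakk>
    \<Longrightarrow> \<one> B \<otimes>\<^sub>a (g \<cdot> f) = (\<one> B \<otimes>\<^sub>a g) \<cdot> (\<one> B \<otimes>\<^sub>a f)"
  using ten_comp[of f "dom \<C> f" "cod \<C> f" g "cod \<C> g" "\<one> B" B B "\<one> B" B]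
    ten_comp[of "\<one> B" B B "\<one> B" B f "dom \<C> f" "cod \<C> f" g "cod \<C> g"]
  by (auto simp: cat_simps)

lemma ten_interchange:
  "\<lbrakk>f \<in> Ar \<C>; f' \<in> Ar \<C>; g \<in> Ar \<C>; g' \<in> Ar \<C>; dom \<C> f' = cod \<C> f; dom \<C> g' = cod \<C> g\<rbrakk>
    \<Longrightarrow> (f' \<otimes>\<^sub>a g') \<cdot> (f \<otimes>\<^sub>a g) = (f' \<cdot> f) \<otimes>\<^sub>a (g' \<cdot> g)"
  using ten_comp[of f "dom \<C> f" "cod \<C> f" f' "cod \<C> f'" g "dom \<C> g" "cod \<C> g" g' "cod \<C> g'"]
  by (simp add: hom_def)

lemma par_interchange:
  "\<lbrakk>f \<in> Ar \<C>; f' \<in> Ar \<C>; g \<in> Ar \<C>; g' \<in> Ar \<C>; dom \<C> f' = cod \<C> f; dom \<C> g' = cod \<C> g\<rbrakk>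
    \<Longrightarrow> (f' \<odot>\<^sub>a g') \<cdot> (f \<odot>\<^sub>a g) = (f' \<cdot> f) \<odot>\<^sub>a (g' \<cdot> g)"
  using par_comp[of f "dom \<C> f" "cod \<C> f" f' "cod \<C> f'" g "dom \<C> g" "cod \<C> g" g' "cod \<C> g'"]
  by (simp add: hom_def)

lemma par_whisker:
  "\<lbrakk>f \<in> Ar \<C>; g \<in> Ar \<C>; dom \<C> g = cod \<C> f; B \<in> Ob \<C>\<rbrakk>
    \<Longrightarrow> (g \<cdot> f) \<odot>\<^sub>a \<one> B = (g \<odot>\<^sub>a \<one> B) \<cdot> (f \<odot>\<^sub>a \<one> B)"
  "\<lbrakk>f \<in> Ar \<C>; g \<in> Ar \<C>; dom \<C> g = cod \<C> f; B \<in> Ob \<C>\<rbrakk>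
    \<Longrightarrow> \<one> B \<odot>\<^sub>a (g \<cdot> f) = (\<one> B \<odot>\<^sub>a g) \<cdot> (\<one> B \<odot>\<^sub>a f)"
  using par_comp[of f "dom \<C> f" "cod \<C> f" g "cod \<C> g" "\<one> B" B B "\<one> B" B]
    par_comp[of "\<one> B" B B "\<one> B" B f "dom \<C> f" "cod \<C> f" g "cod \<C> g"]
  by (auto simp: cat_simps)

lemma structure_simps:
  assumes "A \<in> Ob \<C>" "B \<in> Ob \<C>" "C \<in> Ob \<C>"
  shows "\<alpha> A B C \<in> Ar \<C>" "dom \<C> (\<alpha> A B C) = A \<otimes> (B \<otimes> C)" "cod \<C> (\<alpha> A B C) = (A \<otimes> B) \<otimes> C"
    and "\<beta> A B C \<in> Ar \<C>" "dom \<C> (\<beta> A B C) = A \<odot> (B \<odot> C)" "cod \<C> (\<beta> A B C) = (A \<odot> B) \<odot> C"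
    and "\<delta>\<^sup>l A B C \<in> Ar \<C>" "dom \<C> (\<delta>\<^sup>l A B C) = A \<otimes> (B \<odot> C)" "cod \<C> (\<delta>\<^sup>l A B C) = (A \<otimes> B) \<odot> C"
    and "\<delta>\<^sup>r A B C \<in> Ar \<C>" "dom \<C> (\<delta>\<^sup>r A B C) = (A \<odot> B) \<otimes> C" "cod \<C> (\<delta>\<^sup>r A B C) = A \<odot> (B \<otimes> C)"
  using assoc_ten_hom[OF assms] assoc_par_hom[OF assms] dist_l_hom[OF assms] dist_r_hom[OF assms]
  by (simp_all add: hom_def)

text \<open>Kept apart from the whiskering rules, which split products of composites, against the
  direction of \<open>ten_interchange\<close> and \<open>par_interchange\<close>.\<close>

lemmas typing_simps = cat_simps ten_simps par_simps ten_ob par_ob ten_ident par_ident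
  structure_simps

lemmas lax_simps = typing_simps ten_whisker par_whisker

text \<open>Naturality oriented so as to push arrows to the source side of the structure arrow,
  whose new indices are computed as codomains.\<close>

lemma assoc_ten_slide:
  assumes "f \<in> Ar \<C>" "g \<in> Ar \<C>" "h \<in> Ar \<C>" "dom \<C> f = A" "dom \<C> g = B" "dom \<C> h = C"
  shows "((f \<otimes>\<^sub>a g) \<otimes>\<^sub>a h) \<cdot> \<alpha> A B C = \<alpha> (cod \<C> f) (cod \<C> g) (cod \<C> h) \<cdot> (f \<otimes>\<^sub>a (g \<otimes>\<^sub>a h))"
  using assoc_ten_nat[of f A "cod \<C> f" g B "cod \<C> g" h C "cod \<C> h"] assms by (simp add: hom_def)

lemma assoc_par_slide:
  assumes "f \<in> Ar \<C>" "g \<in> Ar \<C>" "h \<in> Ar \<C>" "dom \<C> f = A" "dom \<C> g = B" "dom \<C> h = C"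
  shows "((f \<odot>\<^sub>a g) \<odot>\<^sub>a h) \<cdot> \<beta> A B C = \<beta> (cod \<C> f) (cod \<C> g) (cod \<C> h) \<cdot> (f \<odot>\<^sub>a (g \<odot>\<^sub>a h))"
  using assoc_par_nat[of f A "cod \<C> f" g B "cod \<C> g" h C "cod \<C> h"] assms by (simp add: hom_def)

lemma dist_l_slide:
  assumes "f \<in> Ar \<C>" "g \<in> Ar \<C>" "h \<in> Ar \<C>" "dom \<C> f = A" "dom \<C> g = B" "dom \<C> h = C"
  shows "((f \<otimes>\<^sub>a g) \<odot>\<^sub>a h) \<cdot> \<delta>\<^sup>l A B C = \<delta>\<^sup>l (cod \<C> f) (cod \<C> g) (cod \<C> h) \<cdot> (f \<otimes>\<^sub>a (g \<odot>\<^sub>a h))"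
  using dist_l_nat[of f A "cod \<C> f" g B "cod \<C> g" h C "cod \<C> h"] assms by (simp add: hom_def)

lemma dist_r_slide:
  assumes "f \<in> Ar \<C>" "g \<in> Ar \<C>" "h \<in> Ar \<C>" "dom \<C> f = A" "dom \<C> g = B" "dom \<C> h = C"
  shows "(f \<odot>\<^sub>a (g \<otimes>\<^sub>a h)) \<cdot> \<delta>\<^sup>r A B C = \<delta>\<^sup>r (cod \<C> f) (cod \<C> g) (cod \<C> h) \<cdot> ((f \<odot>\<^sub>a g) \<otimes>\<^sub>a h)"
  using dist_r_nat[of f A "cod \<C> f" g B "cod \<C> g" h C "cod \<C> h"] assms by (simp add: hom_def)

text \<open>Once \<open>\<one> A \<otimes>\<^sub>a \<one> B\<close> has been rewritten to
  \<open>\<one> (A \<otimes> B)\<close>, the general slides no longer match; these instances cover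
  that form.\<close>

lemma slide_ident:
  assumes "A \<in> Ob \<C>" "B \<in> Ob \<C>" "h \<in> Ar \<C>" "dom \<C> h = C"
  shows "(\<one> (A \<otimes> B) \<otimes>\<^sub>a h) \<cdot> \<alpha> A B C = \<alpha> A B (cod \<C> h) \<cdot> (\<one> A \<otimes>\<^sub>a (\<one> B \<otimes>\<^sub>a h))"
    "(\<one> (A \<odot> B) \<odot>\<^sub>a h) \<cdot> \<beta> A B C = \<beta> A B (cod \<C> h) \<cdot> (\<one> A \<odot>\<^sub>a (\<one> B \<odot>\<^sub>a h))"
    "(\<one> (A \<otimes> B) \<odot>\<^sub>a h) \<cdot> \<delta>\<^sup>l A B C = \<delta>\<^sup>l A B (cod \<C> h) \<cdot> (\<one> A \<otimes>\<^sub>a (\<one> B \<odot>\<^sub>a h))"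
    "(h \<odot>\<^sub>a \<one> (A \<otimes> B)) \<cdot> \<delta>\<^sup>r C A B = \<delta>\<^sup>r (cod \<C> h) A B \<cdot> ((h \<odot>\<^sub>a \<one> A) \<otimes>\<^sub>a \<one> B)"
  using assoc_ten_slide[of "\<one> A" "\<one> B" h A B C] assoc_par_slide[of "\<one> A" "\<one> B" h A B C]
    dist_l_slide[of "\<one> A" "\<one> B" h A B C] dist_r_slide[of h "\<one> A" "\<one> B" C A B] assms
  by (simp_all add: lax_simps)

lemmas slides = assoc_ten_slide assoc_par_slide dist_l_slide dist_r_slide slide_ident

end

section \<open>The dual category\<close>

text \<open>The order of the arguments is reversed so that the associators keep their direction.\<close>

definition dual :: "('o, 'm) ld_structure \<Rightarrow> ('o, 'm) ld_structure" where
  "dual \<C> = \<lparr>Ob = Ob \<C>, Ar = Ar \<C>, dom = cod \<C>, cod = dom \<C>,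
     ident = ident \<C>, comp = (\<lambda>g f. comp \<C> f g),
     tenO = (\<lambda>A B. parO \<C> B A), tenA = (\<lambda>f g. parA \<C> g f),
     parO = (\<lambda>A B. tenO \<C> B A), parA = (\<lambda>f g. tenA \<C> g f),
     assoc_ten = (\<lambda>A B C. assoc_par \<C> C B A),
     assoc_par = (\<lambda>A B C. assoc_ten \<C> C B A),
     dist_l = (\<lambda>A B C. dist_l \<C> C B A),
     dist_r = (\<lambda>A B C. dist_r \<C> C B A)\<rparr>"

lemma dual_simps [simp]:
  "Ob (dual \<C>) = Ob \<C>" "Ar (dual \<C>) = Ar \<C>" "dom (dual \<C>) = cod \<C>" "cod (dual \<C>) = dom \<C>"
  "ident (dual \<C>) = ident \<C>" "comp (dual \<C>) g f = comp \<C> f g"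
  "tenO (dual \<C>) A B = parO \<C> B A" "tenA (dual \<C>) f g = parA \<C> g f"
  "parO (dual \<C>) A B = tenO \<C> B A" "parA (dual \<C>) f g = tenA \<C> g f"
  "assoc_ten (dual \<C>) A B C = assoc_par \<C> C B A" "assoc_par (dual \<C>) A B C = assoc_ten \<C> C B A"
  "dist_l (dual \<C>) A B C = dist_l \<C> C B A" "dist_r (dual \<C>) A B C = dist_r \<C> C B A"
  by (simp_all add: dual_def)

lemma hom_dual [simp]: "hom (dual \<C>) A B = hom \<C> B A"
  by (auto simp: hom_def)

text \<open>Duality exchanges P1 with P8, P2 with P4, P3 with P6 and P5 with P7.\<close>

lemma lax_ld_category_dual:
  assumes "lax_ld_category \<C>" shows "lax_ld_category (dual \<C>)"
proof -
  interpret lax_ld_category \<C> by fact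
  show ?thesis
    by unfold_locales
      (simp_all add: dom_in cod_in ident_hom comp_hom ident_left ident_right comp_assoc
        ten_ob ten_hom ten_ident ten_comp par_ob par_hom par_ident par_comp
        assoc_ten_hom assoc_par_hom dist_l_hom dist_r_hom
        assoc_ten_nat assoc_par_nat dist_l_nat dist_r_nat,
       simp_all add: lax_simps P1 P2 P3 P4 P5 P6 P7 P8)
qed

section \<open>Mates of the coherence axioms under the inverse of the par associator\<close>

context ld_category
begin

lemma assoc_par_inv_simps:
  assumes "A \<in> Ob \<C>" "B \<in> Ob \<C>" "C \<in> Ob \<C>"
  shows "inv_arrow \<C> (\<beta> A B C) \<in> Ar \<C>"
    and "dom \<C> (inv_arrow \<C> (\<beta> A B C)) = (A \<odot> B) \<odot> C"
    and "cod \<C> (inv_arrow \<C> (\<beta> A B C)) = A \<odot> (B \<odot> C)"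
    and "inv_arrow \<C> (\<beta> A B C) \<cdot> \<beta> A B C = \<one> (A \<odot> (B \<odot> C))"
    and "\<beta> A B C \<cdot> inv_arrow \<C> (\<beta> A B C) = \<one> ((A \<odot> B) \<odot> C)"
  using inv_arrow[OF assoc_par_iso[OF assms]] assms
  by (simp_all add: inverse_arrows_def lax_simps)

text \<open>Whiskering preserves inverses; the sides recorded are those cancelled in the mates
  below.\<close>

lemma assoc_par_inv_whisker:
  assumes "A \<in> Ob \<C>" "B \<in> Ob \<C>" "C \<in> Ob \<C>" "D \<in> Ob \<C>"
  shows "(inv_arrow \<C> (\<beta> A B C) \<odot>\<^sub>a \<one> D) \<cdot> (\<beta> A B C \<odot>\<^sub>a \<one> D) = \<one> ((A \<odot> (B \<odot> C)) \<odot> D)"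
    and "(\<one> D \<odot>\<^sub>a \<beta> A B C) \<cdot> (\<one> D \<odot>\<^sub>a inv_arrow \<C> (\<beta> A B C)) = \<one> (D \<odot> ((A \<odot> B) \<odot> C))"
    and "(\<one> D \<otimes>\<^sub>a \<beta> A B C) \<cdot> (\<one> D \<otimes>\<^sub>a inv_arrow \<C> (\<beta> A B C)) = \<one> (D \<otimes> ((A \<odot> B) \<odot> C))"
    and "(\<beta> A B C \<otimes>\<^sub>a \<one> D) \<cdot> (inv_arrow \<C> (\<beta> A B C) \<otimes>\<^sub>a \<one> D) = \<one> (((A \<odot> B) \<odot> C) \<otimes> D)"
  using assms
    par_whisker(1)[of "\<beta> A B C" "inv_arrow \<C> (\<beta> A B C)" D]
    par_whisker(2)[of "inv_arrow \<C> (\<beta> A B C)" "\<beta> A B C" D]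
    ten_whisker(2)[of "inv_arrow \<C> (\<beta> A B C)" "\<beta> A B C" D]
    ten_whisker(1)[of "inv_arrow \<C> (\<beta> A B C)" "\<beta> A B C" D]
  by (simp_all add: lax_simps assoc_par_inv_simps)

lemmas assoc_par_inv_reduce = assoc_par_inv_simps assoc_par_inv_simps(4,5)[THEN comp_extend2]

lemmas ld_simps = lax_simps assoc_par_inv_reduce assoc_par_inv_whisker
  assoc_par_inv_whisker[THEN comp_extend2]

lemma assoc_par_inv_slide:
  assumes "f \<in> Ar \<C>" "g \<in> Ar \<C>" "h \<in> Ar \<C>" "dom \<C> f = A" "dom \<C> g = B" "dom \<C> h = C"
  shows "(f \<odot>\<^sub>a (g \<odot>\<^sub>a h)) \<cdot> inv_arrow \<C> (\<beta> A B C)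
    = inv_arrow \<C> (\<beta> (cod \<C> f) (cod \<C> g) (cod \<C> h)) \<cdot> ((f \<odot>\<^sub>a g) \<odot>\<^sub>a h)" (is "?x \<cdot> ?b = ?b' \<cdot> ?y")
proof -
  have o: "A \<in> Ob \<C>" "B \<in> Ob \<C>" "C \<in> Ob \<C>" "cod \<C> f \<in> Ob \<C>" "cod \<C> g \<in> Ob \<C>" "cod \<C> h \<in> Ob \<C>"
    using assms dom_in cod_in by auto
  have "(?b' \<cdot> ?y) \<cdot> \<beta> A B C = ?x"
    using assms o by (simp add: ld_simps assoc_par_slide)
  from eq_comp_right_inverse[OF this, of ?b] show ?thesis
    using assms o by (simp add: ld_simps)
qed

text \<open>Cutting at a par below the left argument of another par involves the inverse of \<beta>,
  so lifting such a cut along a generator needs axioms with associators moved across as inverses.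
  This one serves a par inside the first factor of \<open>Be\<close>.\<close>

lemma P8_mate_left:
  assumes "A \<in> Ob \<C>" "B \<in> Ob \<C>" "C \<in> Ob \<C>" "D \<in> Ob \<C>"
  shows "inv_arrow \<C> (\<beta> A (B \<odot> C) D) \<cdot> (inv_arrow \<C> (\<beta> A B C) \<odot>\<^sub>a \<one> D) \<cdot> \<beta> (A \<odot> B) C D
    = (\<one> A \<odot>\<^sub>a \<beta> B C D) \<cdot> inv_arrow \<C> (\<beta> A B (C \<odot> D))"
proof -
  \<comment> \<open>Composing with this associator on the source side makes P8 applicable; the
    inverses then cancel.\<close>
  have "(inv_arrow \<C> (\<beta> A (B \<odot> C) D) \<cdot> (inv_arrow \<C> (\<beta> A B C) \<odot>\<^sub>a \<one> D) \<cdot> \<beta> (A \<odot> B) C D)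
      \<cdot> (\<beta> A B (C \<odot> D))
    = \<one> A \<odot>\<^sub>a \<beta> B C D"
    using assms by (simp add: ld_simps P8[THEN comp_extend2] P8)
  from eq_comp_right_inverse[OF this, of "inv_arrow \<C> (\<beta> A B (C \<odot> D))"] show ?thesis
    using assms by (simp add: ld_simps)
qed

text \<open>The form of P8 for a par inside the middle factor of \<open>Be\<close>.\<close>

lemma P8_mate_inner:
  assumes "A \<in> Ob \<C>" "B \<in> Ob \<C>" "C \<in> Ob \<C>" "D \<in> Ob \<C>"
  shows "inv_arrow \<C> (\<beta> (A \<odot> B) C D) \<cdot> (\<beta> A B C \<odot>\<^sub>a \<one> D) \<cdot> \<beta> A (B \<odot> C) D
    = \<beta> A B (C \<odot> D) \<cdot> (\<one> A \<odot>\<^sub>a inv_arrow \<C> (\<beta> B C D))"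
proof -
  have "(inv_arrow \<C> (\<beta> (A \<odot> B) C D) \<cdot> (\<beta> A B C \<odot>\<^sub>a \<one> D) \<cdot> \<beta> A (B \<odot> C) D)
      \<cdot> (\<one> A \<odot>\<^sub>a \<beta> B C D)
    = \<beta> A B (C \<odot> D)"
    using assms by (simp add: ld_simps P8[symmetric])
  from eq_comp_right_inverse[OF this, of "\<one> A \<odot>\<^sub>a inv_arrow \<C> (\<beta> B C D)"] show ?thesis
    using assms by (simp add: ld_simps)
qed

text \<open>The form of P4 for a par inside the middle factor of \<open>Dl\<close>.\<close>

lemma P4_mate:
  assumes "A \<in> Ob \<C>" "B \<in> Ob \<C>" "C \<in> Ob \<C>" "D \<in> Ob \<C>"
  shows "inv_arrow \<C> (\<beta> (A \<otimes> B) C D) \<cdot> (\<delta>\<^sup>l A B C \<odot>\<^sub>a \<one> D) \<cdot> \<delta>\<^sup>l A (B \<odot> C) D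
    = \<delta>\<^sup>l A B (C \<odot> D) \<cdot> (\<one> A \<otimes>\<^sub>a inv_arrow \<C> (\<beta> B C D))"
proof -
  have "(inv_arrow \<C> (\<beta> (A \<otimes> B) C D) \<cdot> (\<delta>\<^sup>l A B C \<odot>\<^sub>a \<one> D) \<cdot> \<delta>\<^sup>l A (B \<odot> C) D)
      \<cdot> (\<one> A \<otimes>\<^sub>a \<beta> B C D)
    = \<delta>\<^sup>l A B (C \<odot> D)"
    using assms by (simp add: ld_simps P4[symmetric])
  from eq_comp_right_inverse[OF this, of "\<one> A \<otimes>\<^sub>a inv_arrow \<C> (\<beta> B C D)"] show ?thesis
    using assms by (simp add: ld_simps)
qed

text \<open>The form of P7 for a par inside the first factor of \<open>Dr\<close>.\<close>

lemma P7_mate: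
  assumes "A \<in> Ob \<C>" "B \<in> Ob \<C>" "C \<in> Ob \<C>" "D \<in> Ob \<C>"
  shows "inv_arrow \<C> (\<beta> A B (C \<otimes> D)) \<cdot> \<delta>\<^sup>r (A \<odot> B) C D
    = (\<one> A \<odot>\<^sub>a \<delta>\<^sup>r B C D) \<cdot> \<delta>\<^sup>r A (B \<odot> C) D \<cdot> (inv_arrow \<C> (\<beta> A B C) \<otimes>\<^sub>a \<one> D)"
proof -
  have "(inv_arrow \<C> (\<beta> A B (C \<otimes> D)) \<cdot> \<delta>\<^sup>r (A \<odot> B) C D)
      \<cdot> (\<beta> A B C \<otimes>\<^sub>a \<one> D)
    = (\<one> A \<odot>\<^sub>a \<delta>\<^sup>r B C D) \<cdot> \<delta>\<^sup>r A (B \<odot> C) D"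
    using assms by (simp add: ld_simps P7)
  from eq_comp_right_inverse[OF this, of "inv_arrow \<C> (\<beta> A B C) \<otimes>\<^sub>a \<one> D"] show ?thesis
    using assms by (simp add: ld_simps)
qed

end

section \<open>Cutting an expression at a par\<close>

text \<open>\<open>cut k A L R c\<close>: the arrow \<open>c\<close> from \<open>A\<close> to \<open>L \<odot>\<^sub>e R\<close> lifts a par node of \<open>A\<close> to the root.\<close>

inductive cut :: "flavour \<Rightarrow> 'a expr \<Rightarrow> 'a expr \<Rightarrow> 'a expr \<Rightarrow> 'a arrow_term \<Rightarrow> bool"
  for k :: flavour where
  root: "cut k (A \<odot>\<^sub>e B) A B (Idt (A \<odot>\<^sub>e B))"
| ten_left: "cut k A L R c \<Longrightarrow> cut k (A \<otimes>\<^sub>e B) L (R \<otimes>\<^sub>e B) (Dr L R B \<circ>\<^sub>t (c \<otimes>\<^sub>t Idt B))"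
| ten_right: "cut k B L R c \<Longrightarrow> cut k (A \<otimes>\<^sub>e B) (A \<otimes>\<^sub>e L) R (Dl A L R \<circ>\<^sub>t (Idt A \<otimes>\<^sub>t c))"
| par_left: "\<lbrakk>k = LD; cut k A L R c\<rbrakk>
    \<Longrightarrow> cut k (A \<odot>\<^sub>e B) L (R \<odot>\<^sub>e B) (BeInv L R B \<circ>\<^sub>t (c \<odot>\<^sub>t Idt B))"
| par_right: "cut k B L R c \<Longrightarrow> cut k (A \<odot>\<^sub>e B) (A \<odot>\<^sub>e L) R (Be A L R \<circ>\<^sub>t (Idt A \<odot>\<^sub>t c))"

inductive_cases cut_TenE [consumes 1, case_names left right]: "cut k (A \<otimes>\<^sub>e B) L R c"
inductive_cases cut_ParE [consumes 1, case_names root left right]: "cut k (A \<odot>\<^sub>e B) L R c"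

lemma cut_wf:
  "\<lbrakk>cut k A L R c; A \<in> exprs S\<rbrakk>
    \<Longrightarrow> wf_term k S c \<and> src c = A \<and> tgt c = L \<odot>\<^sub>e R \<and> L \<in> exprs S \<and> R \<in> exprs S"
  by (induction rule: cut.induct) auto

text \<open>Serves twice: as the measure of the final induction and, taken on the left part of a
  cut, as the position of that cut.\<close>

primrec leaves :: "'a expr \<Rightarrow> nat" where
  "leaves (Gen a) = 1"
| "leaves (A \<otimes>\<^sub>e B) = leaves A + leaves B"
| "leaves (A \<odot>\<^sub>e B) = leaves A + leaves B"

lemma leaves_pos: "leaves A > 0"
  by (induction A) auto

lemma leaves_src_tgt: "wf_term k S f \<Longrightarrow> leaves (src f) = leaves (tgt f)"
  by (induction f) auto

lemma cut_leaves: "cut k A L R c \<Longrightarrow> leaves A = leaves L + leaves R"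
  by (induction rule: cut.induct) auto

text \<open>Cuts keep the order of the leaves, so \<open>leaves L\<close> locates the lifted par:
  below a node with left argument \<open>A\<close> it is less than \<open>leaves A\<close> for a cut
  inside \<open>A\<close>, greater for a cut inside the right argument, and equal only at the root.
  Both derivations therefore apply the same rule at every node.\<close>

lemma cut_unique:
  "\<lbrakk>cut k A L R c; cut k A L' R' c'; leaves L = leaves L'\<rbrakk> \<Longrightarrow> L = L' \<and> R = R' \<and> c = c'"
proof (induction arbitrary: L' R' c' rule: cut.induct)
  case (root A B)
  from root(1) show ?case
  proof (cases rule: cut_ParE)
    case (left Q d)
    with cut_leaves[OF left(4)] leaves_pos[of Q] root(2) show ?thesis by simp
  next
    case (right M d)
    with leaves_pos[of M] root(2) show ?thesis by simp
  qed simp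
next
  case (ten_left A L R c B)
  from ten_left(3) show ?case
  proof (cases rule: cut_TenE)
    case (left Q d)
    with ten_left.IH[OF left(3)] ten_left(4) show ?thesis by simp
  next
    case (right M d)
    with ten_left(4) cut_leaves[OF ten_left(1)] leaves_pos[of R] show ?thesis by simp
  qed
next
  case (ten_right B L R c A)
  from ten_right(3) show ?case
  proof (cases rule: cut_TenE)
    case (left Q d)
    with ten_right(4) cut_leaves[OF left(3)] leaves_pos[of Q] show ?thesis by simp
  next
    case (right M d)
    with ten_right.IH[OF right(3)] ten_right(4) show ?thesis by simp
  qed
next
  case (par_left A L R c B)
  note le = cut_leaves[OF par_left(2)] leaves_pos[of R]
  from par_left(4) show ?case
  proof (cases rule: cut_ParE)
    case root
    with par_left(5) le show ?thesis by simp
  next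
    case (left Q d)
    with par_left.IH[OF left(4)[folded par_left(1)]] par_left(5) show ?thesis by simp
  next
    case (right M d)
    with par_left(5) le show ?thesis by simp
  qed
next
  case (par_right B L R c A)
  from par_right(3) show ?case
  proof (cases rule: cut_ParE)
    case root
    with par_right(4) leaves_pos[of L] show ?thesis by simp
  next
    case (left Q d)
    with par_right(4) cut_leaves[OF left(4)] leaves_pos[of Q] show ?thesis by simp
  next
    case (right M d)
    with par_right.IH[OF right(3)] par_right(4) show ?thesis by simp
  qed
qed

section \<open>Naturality of cuts\<close>

context
  fixes k :: flavour and \<C> :: "('o, 'm, 'z) ld_structure_scheme" (structure)
    and S :: "'a set" and \<phi> :: "'a \<Rightarrow> 'o"
  assumes model: "ld_model k \<C>" and phi: "\<And>a. a \<in> S \<Longrightarrow> \<phi> a \<in> Ob \<C>"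
begin

interpretation lax_ld_category \<C> using model by (simp add: ld_model_def)

private abbreviation evO ("\<lbrakk>_\<rbrakk>\<^sub>o") where "\<lbrakk>A\<rbrakk>\<^sub>o \<equiv> evalO \<C> \<phi> A"
private abbreviation evA ("\<lbrakk>_\<rbrakk>") where "\<lbrakk>f\<rbrakk> \<equiv> evalA \<C> \<phi> f"

lemma evalO_Ob: "A \<in> exprs S \<Longrightarrow> \<lbrakk>A\<rbrakk>\<^sub>o \<in> Ob \<C>"
  by (rule evalO_in[OF model phi])

lemma eval_inverses:
  assumes "k = LD" "A \<in> exprs S" "B \<in> exprs S" "C \<in> exprs S"
  shows "inv_arrow \<C> (\<alpha> \<lbrakk>A\<rbrakk>\<^sub>o \<lbrakk>B\<rbrakk>\<^sub>o \<lbrakk>C\<rbrakk>\<^sub>o) \<cdot> \<alpha> \<lbrakk>A\<rbrakk>\<^sub>o \<lbrakk>B\<rbrakk>\<^sub>o \<lbrakk>C\<rbrakk>\<^sub>o = \<one> (\<lbrakk>A\<rbrakk>\<^sub>o \<otimes> (\<lbrakk>B\<rbrakk>\<^sub>o \<otimes> \<lbrakk>C\<rbrakk>\<^sub>o))"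
    and "\<alpha> \<lbrakk>A\<rbrakk>\<^sub>o \<lbrakk>B\<rbrakk>\<^sub>o \<lbrakk>C\<rbrakk>\<^sub>o \<cdot> inv_arrow \<C> (\<alpha> \<lbrakk>A\<rbrakk>\<^sub>o \<lbrakk>B\<rbrakk>\<^sub>o \<lbrakk>C\<rbrakk>\<^sub>o) = \<one> ((\<lbrakk>A\<rbrakk>\<^sub>o \<otimes> \<lbrakk>B\<rbrakk>\<^sub>o) \<otimes> \<lbrakk>C\<rbrakk>\<^sub>o)"
    and "inv_arrow \<C> (\<beta> \<lbrakk>A\<rbrakk>\<^sub>o \<lbrakk>B\<rbrakk>\<^sub>o \<lbrakk>C\<rbrakk>\<^sub>o) \<cdot> \<beta> \<lbrakk>A\<rbrakk>\<^sub>o \<lbrakk>B\<rbrakk>\<^sub>o \<lbrakk>C\<rbrakk>\<^sub>o = \<one> (\<lbrakk>A\<rbrakk>\<^sub>o \<odot> (\<lbrakk>B\<rbrakk>\<^sub>o \<odot> \<lbrakk>C\<rbrakk>\<^sub>o))"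
    and "\<beta> \<lbrakk>A\<rbrakk>\<^sub>o \<lbrakk>B\<rbrakk>\<^sub>o \<lbrakk>C\<rbrakk>\<^sub>o \<cdot> inv_arrow \<C> (\<beta> \<lbrakk>A\<rbrakk>\<^sub>o \<lbrakk>B\<rbrakk>\<^sub>o \<lbrakk>C\<rbrakk>\<^sub>o) = \<one> ((\<lbrakk>A\<rbrakk>\<^sub>o \<odot> \<lbrakk>B\<rbrakk>\<^sub>o) \<odot> \<lbrakk>C\<rbrakk>\<^sub>o)"
  using assms
  by (simp_all add: inverses'[where S = S and \<phi> = \<phi>, OF model phi] evalO_Ob)

lemma evalA_simps:
  assumes "wf_term k S f"
  shows "\<lbrakk>f\<rbrakk> \<in> Ar \<C>" "dom \<C> \<lbrakk>f\<rbrakk> = \<lbrakk>src f\<rbrakk>\<^sub>o" "cod \<C> \<lbrakk>f\<rbrakk> = \<lbrakk>tgt f\<rbrakk>\<^sub>o"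
  using evalA_hom[OF model phi assms] by (simp_all add: hom_def)

lemma cut_simps:
  assumes "cut k A L R c" "A \<in> exprs S"
  shows "\<lbrakk>c\<rbrakk> \<in> Ar \<C>" "dom \<C> \<lbrakk>c\<rbrakk> = \<lbrakk>A\<rbrakk>\<^sub>o" "cod \<C> \<lbrakk>c\<rbrakk> = \<lbrakk>L\<rbrakk>\<^sub>o \<odot> \<lbrakk>R\<rbrakk>\<^sub>o"
    "\<lbrakk>L\<rbrakk>\<^sub>o \<in> Ob \<C>" "\<lbrakk>R\<rbrakk>\<^sub>o \<in> Ob \<C>" "L \<in> exprs S" "R \<in> exprs S"
  using cut_wf[OF assms] evalA_simps[of c] evalO_Ob by auto

text \<open>In the lax flavour \<open>reversible\<close> is vacuous, so that the lemmas on \<open>Al\<close> and \<open>Be\<close> serve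
  both flavours.\<close>

definition reversible where
  "reversible f \<longleftrightarrow> (k = LD \<longrightarrow> (\<exists>g. wf_term k S g \<and> src g = tgt f \<and> tgt g = src f \<and>
     \<lbrakk>g\<rbrakk> \<cdot> \<lbrakk>f\<rbrakk> = \<one> \<lbrakk>src f\<rbrakk>\<^sub>o))"

lemma reversible_simps:
  "A \<in> exprs S \<Longrightarrow> reversible (Idt A)"
  "\<lbrakk>A \<in> exprs S; B \<in> exprs S; C \<in> exprs S\<rbrakk> \<Longrightarrow> reversible (Al A B C)"
  "\<lbrakk>A \<in> exprs S; B \<in> exprs S; C \<in> exprs S\<rbrakk> \<Longrightarrow> reversible (Be A B C)"
proof -
  show "reversible (Idt A)" if "A \<in> exprs S"
    unfolding reversible_def
    by (intro impI exI[of _ "Idt A"]) (use that in \<open>simp add: lax_simps evalO_Ob\<close>)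
  assume o: "A \<in> exprs S" "B \<in> exprs S" "C \<in> exprs S"
  show "reversible (Al A B C)"
    unfolding reversible_def by (intro impI exI[of _ "AlInv A B C"]) (use o eval_inverses in simp)
  show "reversible (Be A B C)"
    unfolding reversible_def by (intro impI exI[of _ "BeInv A B C"]) (use o eval_inverses in simp)
qed

text \<open>The cut \<open>c'\<close> of the target of \<open>f\<close> restricts along \<open>f\<close> to a cut of its source.\<close>

definition lifts where
  "lifts Q f L' R' c' \<longleftrightarrow> (\<exists>L R c f\<^sub>1 f\<^sub>2. cut k (src f) L R c \<and>
     wf_term k S f\<^sub>1 \<and> src f\<^sub>1 = L \<and> tgt f\<^sub>1 = L' \<and> wf_term k S f\<^sub>2 \<and> src f\<^sub>2 = R \<and> tgt f\<^sub>2 = R' \<and>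
     \<lbrakk>c'\<rbrakk> \<cdot> \<lbrakk>f\<rbrakk> = (\<lbrakk>f\<^sub>1\<rbrakk> \<odot>\<^sub>a \<lbrakk>f\<^sub>2\<rbrakk>) \<cdot> \<lbrakk>c\<rbrakk> \<and> Q f\<^sub>1 \<and> Q f\<^sub>2)"

lemma liftsI:
  "\<lbrakk>cut k (src f) L R c; wf_term k S f\<^sub>1; src f\<^sub>1 = L; tgt f\<^sub>1 = L'; wf_term k S f\<^sub>2; src f\<^sub>2 = R;
    tgt f\<^sub>2 = R'; \<lbrakk>c'\<rbrakk> \<cdot> \<lbrakk>f\<rbrakk> = (\<lbrakk>f\<^sub>1\<rbrakk> \<odot>\<^sub>a \<lbrakk>f\<^sub>2\<rbrakk>) \<cdot> \<lbrakk>c\<rbrakk>; Q f\<^sub>1; Q f\<^sub>2\<rbrakk> \<Longrightarrow> lifts Q f L' R' c'"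
  unfolding lifts_def by blast

lemma liftsE:
  assumes "lifts Q f L' R' c'"
  obtains f\<^sub>1 f\<^sub>2 c where "cut k (src f) (src f\<^sub>1) (src f\<^sub>2) c" "wf_term k S f\<^sub>1" "L' = tgt f\<^sub>1"
    "wf_term k S f\<^sub>2" "R' = tgt f\<^sub>2" "\<lbrakk>c'\<rbrakk> \<cdot> \<lbrakk>f\<rbrakk> = (\<lbrakk>f\<^sub>1\<rbrakk> \<odot>\<^sub>a \<lbrakk>f\<^sub>2\<rbrakk>) \<cdot> \<lbrakk>c\<rbrakk>" "Q f\<^sub>1" "Q f\<^sub>2"
  using assms unfolding lifts_def by blast

lemmas ev_basic = typing_simps evalA_simps evalO_Ob

lemmas ev_simps = lax_simps evalA_simps evalO_Ob slides slides[THEN comp_extend2]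

section \<open>Lifting cuts along associators and distributors\<close>

text \<open>For a par inside \<open>A\<close>, \<open>B\<close> or \<open>C\<close> the square is
  P5, P3 or P2 respectively, up to naturality. The components are identities or associators, hence
  \<open>reversible\<close>, as \<open>lifts_inverse\<close> will require.\<close>

lemma lifts_Al:
  assumes o: "A \<in> exprs S" "B \<in> exprs S" "C \<in> exprs S" and c: "cut k ((A \<otimes>\<^sub>e B) \<otimes>\<^sub>e C) L R c"
  shows "lifts reversible (Al A B C) L R c"
  using c
proof (cases rule: cut_TenE)
  case left': (left X d)
  from left'(3) show ?thesis
  proof (cases rule: cut_TenE)
    case (left Y e)
    note cut_simps[OF left(3) o(1), simp]
    show ?thesis
      by (rule liftsI[where f\<^sub>1 = "Idt L" and f\<^sub>2 = "Al Y B C"],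
          simp add: left'(1,2) left(1,2), rule cut.ten_left, rule left(3))
        (use o in \<open>simp_all add: left'(1,2) left(1,2) ev_simps reversible_simps
          P5[symmetric, THEN comp_extend3]\<close>)
  next
    case (right Y e)
    note cut_simps[OF right(3) o(2), simp]
    show ?thesis
      by (rule liftsI[where f\<^sub>1 = "Idt (A \<otimes>\<^sub>e Y)" and f\<^sub>2 = "Idt (X \<otimes>\<^sub>e C)"],
          simp add: left'(1,2) right(1,2), rule cut.ten_right, rule cut.ten_left, rule right(3))
        (use o in \<open>simp_all add: left'(1,2) right(1,2) ev_simps reversible_simps
          P3[symmetric, THEN comp_extend3]\<close>)
  qed
next
  case (right X d)
  note cut_simps[OF right(3) o(3), simp]
  show ?thesis
    by (rule liftsI[where f\<^sub>1 = "Al A B X" and f\<^sub>2 = "Idt R"],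
        simp add: right(1,2), rule cut.ten_right, rule cut.ten_right, rule right(3))
      (use o in \<open>simp_all add: right(1,2) ev_simps reversible_simps
        P2[THEN comp_extend2]\<close>)
qed

text \<open>The outer par of the target is lifted in the source by \<open>Be\<close> itself; for the
  inner one, \<open>BeInv\<close> cancels against \<open>Be\<close>. A par inside \<open>A\<close>,
  \<open>B\<close> or \<open>C\<close> uses \<open>P8_mate_left\<close>,
  \<open>P8_mate_inner\<close> or P8.\<close>

lemma lifts_Be:
  assumes o: "A \<in> exprs S" "B \<in> exprs S" "C \<in> exprs S" and c: "cut k ((A \<odot>\<^sub>e B) \<odot>\<^sub>e C) L R c"
  shows "lifts reversible (Be A B C) L R c"
  using c
proof (cases rule: cut_ParE)
  case root
  show ?thesis
    by (rule liftsI[where f\<^sub>1 = "Idt (A \<odot>\<^sub>e B)" and f\<^sub>2 = "Idt C"],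
        simp add: root, rule cut.par_right, rule cut.root)
      (use o in \<open>simp_all add: root ev_simps reversible_simps\<close>)
next
  case left': (left X d)
  note ld = left'(3)
  from left'(4) show ?thesis
  proof (cases rule: cut_ParE)
    case root
    \<comment> \<open>A cut through the left argument of a par exists for \<open>k = LD\<close>
      only, so here \<beta> is invertible.\<close>
    interpret ld_category \<C> using model ld by (simp add: ld_model_def)
    show ?thesis
      by (rule liftsI[where f\<^sub>1 = "Idt A" and f\<^sub>2 = "Idt (B \<odot>\<^sub>e C)"],
          simp add: left'(1,2) root, rule cut.root)
        (use o in \<open>simp_all add: left'(1,2) root ev_simps reversible_simps
          assoc_par_inv_reduce\<close>)
  next
    case (left Y e)
    have e: "cut k A L Y e" using ld left(4) by simp
    interpret ld_category \<C> using model ld by (simp add: ld_model_def)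
    note cut_simps[OF e o(1), simp]
    show ?thesis
      by (rule liftsI[where f\<^sub>1 = "Idt L" and f\<^sub>2 = "Be Y B C"],
          simp add: left'(1,2) left(1,2), rule cut.par_left[OF ld], rule e)
        (use o in \<open>simp_all add: left'(1,2) left(1,2) ev_simps reversible_simps
          assoc_par_inv_reduce P8_mate_left[THEN comp_extend3]\<close>)
  next
    case (right Y e)
    have e: "cut k B Y X e" using ld right(3) by simp
    interpret ld_category \<C> using model ld by (simp add: ld_model_def)
    note cut_simps[OF e o(2), simp]
    show ?thesis
      by (rule liftsI[where f\<^sub>1 = "Idt (A \<odot>\<^sub>e Y)" and f\<^sub>2 = "Idt (X \<odot>\<^sub>e C)"],
          simp add: left'(1,2) right(1,2), rule cut.par_right, rule cut.par_left[OF ld], rule e)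
        (use o in \<open>simp_all add: left'(1,2) right(1,2) ev_simps reversible_simps
          assoc_par_inv_reduce P8_mate_inner[THEN comp_extend3]\<close>)
  qed
next
  case (right X d)
  note cut_simps[OF right(3) o(3), simp]
  show ?thesis
    by (rule liftsI[where f\<^sub>1 = "Be A B X" and f\<^sub>2 = "Idt R"],
        simp add: right(1,2), rule cut.par_right, rule cut.par_right, rule right(3))
      (use o in \<open>simp_all add: right(1,2) ev_simps reversible_simps
        P8[THEN comp_extend2]\<close>)
qed

text \<open>The root par is lifted in the source by \<open>Dl\<close> itself; a par inside
  \<open>A\<close>, \<open>B\<close> or \<open>C\<close> uses P6, \<open>P4_mate\<close> or P4.
  Components may be distributors, which have no formal inverse, so \<open>reversible\<close> is
  replaced by the trivial predicate.\<close>

lemma lifts_Dl: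
  assumes o: "A \<in> exprs S" "B \<in> exprs S" "C \<in> exprs S" and c: "cut k ((A \<otimes>\<^sub>e B) \<odot>\<^sub>e C) L R c"
  shows "lifts (\<lambda>_. True) (Dl A B C) L R c"
  using c
proof (cases rule: cut_ParE)
  case root
  show ?thesis
    by (rule liftsI[where f\<^sub>1 = "Idt (A \<otimes>\<^sub>e B)" and f\<^sub>2 = "Idt C"],
        simp add: root, rule cut.ten_right, rule cut.root)
      (use o in \<open>simp_all add: root ev_simps reversible_simps\<close>)
next
  case left': (left X d)
  note ld = left'(3)
  from left'(4) show ?thesis
  proof (cases rule: cut_TenE)
    case (left Y e)
    have e: "cut k A L Y e" using ld left(3) by simp
    interpret ld_category \<C> using model ld by (simp add: ld_model_def)
    note cut_simps[OF e o(1), simp]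
    \<comment> \<open>P6 produces a \<beta> that cancels the inverse contributed by
      \<open>BeInv\<close>.\<close>
    show ?thesis
      by (rule liftsI[where f\<^sub>1 = "Idt L" and f\<^sub>2 = "Dl Y B C"],
          simp add: left'(1,2) left(1,2), rule cut.ten_left, rule e)
        (use o in \<open>simp_all add: left'(1,2) left(1,2) ev_simps reversible_simps
          assoc_par_inv_reduce P6[THEN comp_extend2]\<close>)
  next
    case (right Y e)
    have e: "cut k B Y X e" using ld right(3) by simp
    interpret ld_category \<C> using model ld by (simp add: ld_model_def)
    note cut_simps[OF e o(2), simp]
    show ?thesis
      by (rule liftsI[where f\<^sub>1 = "Idt (A \<otimes>\<^sub>e Y)" and f\<^sub>2 = "Idt (X \<odot>\<^sub>e C)"],
          simp add: left'(1,2) right(1,2), rule cut.ten_right, rule cut.par_left[OF ld], rule e)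
        (use o in \<open>simp_all add: left'(1,2) right(1,2) ev_simps reversible_simps
          assoc_par_inv_reduce P4_mate[THEN comp_extend3]\<close>)
  qed
next
  case (right X d)
  note cut_simps[OF right(3) o(3), simp]
  show ?thesis
    by (rule liftsI[where f\<^sub>1 = "Dl A B X" and f\<^sub>2 = "Idt R"],
        simp add: right(1,2), rule cut.ten_right, rule cut.par_right, rule right(3))
      (use o in \<open>simp_all add: right(1,2) ev_simps reversible_simps
        P4[THEN comp_extend2]\<close>)
qed

text \<open>The root par is lifted in the source by \<open>Dr\<close> itself; a par inside
  \<open>A\<close>, \<open>B\<close> or \<open>C\<close> uses \<open>P7_mate\<close>, P7 or
  P6.\<close>

lemma lifts_Dr:
  assumes o: "A \<in> exprs S" "B \<in> exprs S" "C \<in> exprs S" and c: "cut k (A \<odot>\<^sub>e (B \<otimes>\<^sub>e C)) L R c"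
  shows "lifts (\<lambda>_. True) (Dr A B C) L R c"
  using c
proof (cases rule: cut_ParE)
  case root
  show ?thesis
    by (rule liftsI[where f\<^sub>1 = "Idt A" and f\<^sub>2 = "Idt (B \<otimes>\<^sub>e C)"],
        simp add: root, rule cut.ten_left, rule cut.root)
      (use o in \<open>simp_all add: root ev_simps reversible_simps\<close>)
next
  case (left X d)
  note ld = left(3)
  have d: "cut k A L X d" using ld left(4) by simp
  interpret ld_category \<C> using model ld by (simp add: ld_model_def)
  note cut_simps[OF d o(1), simp]
  show ?thesis
    by (rule liftsI[where f\<^sub>1 = "Idt L" and f\<^sub>2 = "Dr X B C"],
        simp add: left(1,2), rule cut.ten_left, rule cut.par_left[OF ld], rule d)
      (use o in \<open>simp_all add: left(1,2) ev_simps reversible_simps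
        assoc_par_inv_reduce P7_mate[THEN comp_extend2]\<close>)
next
  case right': (right X d)
  from right'(3) show ?thesis
  proof (cases rule: cut_TenE)
    case (left Y e)
    note cut_simps[OF left(3) o(2), simp]
    show ?thesis
      by (rule liftsI[where f\<^sub>1 = "Idt (A \<odot>\<^sub>e X)" and f\<^sub>2 = "Idt (Y \<otimes>\<^sub>e C)"],
          simp add: right'(1,2) left(1,2), rule cut.ten_left, rule cut.par_right, rule left(3))
        (use o in \<open>simp_all add: right'(1,2) left(1,2) ev_simps reversible_simps
          P7[symmetric, THEN comp_extend3]\<close>)
  next
    case (right Y e)
    note cut_simps[OF right(3) o(3), simp]
    show ?thesis
      by (rule liftsI[where f\<^sub>1 = "Dr A B Y" and f\<^sub>2 = "Idt R"],
          simp add: right'(1,2) right(1,2), rule cut.ten_right, rule right(3))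
        (use o in \<open>simp_all add: right'(1,2) right(1,2) ev_simps reversible_simps
          P6[symmetric, THEN comp_extend3]\<close>)
  qed
qed

section \<open>Lifting cuts along inverses, products and composites\<close>

text \<open>The cut \<open>c\<close>, at the same position as \<open>c'\<close>, lifts along
  \<open>f\<close> to \<open>c'\<close> by uniqueness of cuts; inverting the two components turns
  that square into one for \<open>g\<close>.\<close>

lemma lifts_inverse:
  assumes ld: "k = LD" and f: "wf_term k S f" and g: "wf_term k S g" "src g = tgt f" "tgt g = src f"
    and fg: "\<lbrakk>f\<rbrakk> \<cdot> \<lbrakk>g\<rbrakk> = \<one> \<lbrakk>tgt f\<rbrakk>\<^sub>o"
    and c: "cut k (tgt f) L R c" and c': "cut k (tgt g) L' R' c'" "leaves L = leaves L'"
    and lift: "lifts reversible f L R c"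
  shows "lifts (\<lambda>_. True) g L' R' c'"
proof -
  from lift obtain f\<^sub>1 f\<^sub>2 d where d: "cut k (src f) (src f\<^sub>1) (src f\<^sub>2) d"
    and f': "wf_term k S f\<^sub>1" "L = tgt f\<^sub>1" "wf_term k S f\<^sub>2" "R = tgt f\<^sub>2"
    and eq: "\<lbrakk>c\<rbrakk> \<cdot> \<lbrakk>f\<rbrakk> = (\<lbrakk>f\<^sub>1\<rbrakk> \<odot>\<^sub>a \<lbrakk>f\<^sub>2\<rbrakk>) \<cdot> \<lbrakk>d\<rbrakk>" and inv: "reversible f\<^sub>1" "reversible f\<^sub>2"
    by (rule liftsE)
  \<comment> \<open>As \<open>f\<^sub>1\<close> preserves the number of leaves, the lifted cut
    \<open>d\<close> sits at the position of \<open>c'\<close>.\<close>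
  have "L' = src f\<^sub>1 \<and> R' = src f\<^sub>2 \<and> c' = d"
    using cut_unique[OF c'(1)] d c'(2) f' leaves_src_tgt[OF f'(1)] g by simp
  then have d: "cut k (src f) L' R' c'" "src f\<^sub>1 = L'" "src f\<^sub>2 = R'"
    and eq: "\<lbrakk>c\<rbrakk> \<cdot> \<lbrakk>f\<rbrakk> = (\<lbrakk>f\<^sub>1\<rbrakk> \<odot>\<^sub>a \<lbrakk>f\<^sub>2\<rbrakk>) \<cdot> \<lbrakk>c'\<rbrakk>"
    using d eq by simp_all
  from inv obtain g\<^sub>1 g\<^sub>2 where g': "wf_term k S g\<^sub>1" "src g\<^sub>1 = L" "tgt g\<^sub>1 = L'" "\<lbrakk>g\<^sub>1\<rbrakk> \<cdot> \<lbrakk>f\<^sub>1\<rbrakk> = \<one> \<lbrakk>L'\<rbrakk>\<^sub>o"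
    "wf_term k S g\<^sub>2" "src g\<^sub>2 = R" "tgt g\<^sub>2 = R'" "\<lbrakk>g\<^sub>2\<rbrakk> \<cdot> \<lbrakk>f\<^sub>2\<rbrakk> = \<one> \<lbrakk>R'\<rbrakk>\<^sub>o"
    using d f' ld unfolding reversible_def by metis
  note cs = cut_simps[OF c] cut_simps[OF d(1)] wf_src_tgt[OF f]
  \<comment> \<open>Left inverses of the components solve the lifting square for
    \<open>c'\<close>.\<close>
  have "\<lbrakk>c'\<rbrakk> = ((\<lbrakk>g\<^sub>1\<rbrakk> \<odot>\<^sub>a \<lbrakk>g\<^sub>2\<rbrakk>) \<cdot> (\<lbrakk>f\<^sub>1\<rbrakk> \<odot>\<^sub>a \<lbrakk>f\<^sub>2\<rbrakk>)) \<cdot> \<lbrakk>c'\<rbrakk>"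
    using f f' g' d cs by (simp add: par_interchange lax_simps evalA_simps)
  also have "\<dots> = (\<lbrakk>g\<^sub>1\<rbrakk> \<odot>\<^sub>a \<lbrakk>g\<^sub>2\<rbrakk>) \<cdot> \<lbrakk>c\<rbrakk> \<cdot> \<lbrakk>f\<rbrakk>"
    using f f' g' d cs by (simp add: lax_simps evalA_simps eq)
  finally have "\<lbrakk>c'\<rbrakk> \<cdot> \<lbrakk>g\<rbrakk> = ((\<lbrakk>g\<^sub>1\<rbrakk> \<odot>\<^sub>a \<lbrakk>g\<^sub>2\<rbrakk>) \<cdot> \<lbrakk>c\<rbrakk> \<cdot> \<lbrakk>f\<rbrakk>) \<cdot> \<lbrakk>g\<rbrakk>"
    by simp
  also have "\<dots> = (\<lbrakk>g\<^sub>1\<rbrakk> \<odot>\<^sub>a \<lbrakk>g\<^sub>2\<rbrakk>) \<cdot> \<lbrakk>c\<rbrakk>"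
    using f f' g g' d cs by (simp add: lax_simps evalA_simps fg)
  finally show ?thesis
    using c g g' by (intro liftsI[of g L R c g\<^sub>1 L' g\<^sub>2]) simp_all
qed

text \<open>A cut of a tensor is a cut of one factor followed by a distributor: the square for that
  factor is tensored with the other arrow and pasted to naturality of the distributor.\<close>

lemma lifts_Ten:
  assumes f: "wf_term k S f" "\<And>L R c. cut k (tgt f) L R c \<Longrightarrow> lifts (\<lambda>_. True) f L R c"
    and g: "wf_term k S g" "\<And>L R c. cut k (tgt g) L R c \<Longrightarrow> lifts (\<lambda>_. True) g L R c"
    and c: "cut k (tgt f \<otimes>\<^sub>e tgt g) L R c"
  shows "lifts (\<lambda>_. True) (f \<otimes>\<^sub>t g) L R c"
  using c
proof (cases rule: cut_TenE)
  case (left X d)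
  from f(2)[OF left(3)] show ?thesis
  proof (cases rule: liftsE)
    case (1 f\<^sub>1 f\<^sub>2 e)
    note w = f(1) g(1) 1(2,4) wf_src_tgt[OF f(1)] wf_src_tgt[OF g(1)]
      wf_src_tgt[OF 1(2)] wf_src_tgt[OF 1(4)]
      cut_simps[OF left(3)] cut_simps[OF 1(1)]
    \<comment> \<open>Interchange makes both sides products with second factor
      \<open>\<lbrakk>g\<rbrakk>\<close>, leaving the square for \<open>f\<close>.\<close>
    have h: "(\<lbrakk>d\<rbrakk> \<otimes>\<^sub>a \<one> \<lbrakk>tgt g\<rbrakk>\<^sub>o) \<cdot> (\<lbrakk>f\<rbrakk> \<otimes>\<^sub>a \<lbrakk>g\<rbrakk>)
      = ((\<lbrakk>f\<^sub>1\<rbrakk> \<odot>\<^sub>a \<lbrakk>f\<^sub>2\<rbrakk>) \<otimes>\<^sub>a \<lbrakk>g\<rbrakk>) \<cdot> (\<lbrakk>e\<rbrakk> \<otimes>\<^sub>a \<one> \<lbrakk>src g\<rbrakk>\<^sub>o)"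
      using w 1 by (simp add: ten_interchange ev_basic)
    show ?thesis
      by (rule liftsI[where f\<^sub>1 = f\<^sub>1 and f\<^sub>2 = "f\<^sub>2 \<otimes>\<^sub>t g"],
          simp, rule cut.ten_left, rule 1(1))
        (use w in \<open>simp_all add: 1(3,5) h h[THEN comp_extend2] left(1,2) ev_basic
          slides slides[THEN comp_extend2]\<close>)
  qed
next
  case (right X d)
  from g(2)[OF right(3)] show ?thesis
  proof (cases rule: liftsE)
    case (1 g\<^sub>1 g\<^sub>2 e)
    note w = f(1) g(1) 1(2,4) wf_src_tgt[OF f(1)] wf_src_tgt[OF g(1)]
      wf_src_tgt[OF 1(2)] wf_src_tgt[OF 1(4)]
      cut_simps[OF right(3)] cut_simps[OF 1(1)]
    have h: "(\<one> \<lbrakk>tgt f\<rbrakk>\<^sub>o \<otimes>\<^sub>a \<lbrakk>d\<rbrakk>) \<cdot> (\<lbrakk>f\<rbrakk> \<otimes>\<^sub>a \<lbrakk>g\<rbrakk>)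
      = (\<lbrakk>f\<rbrakk> \<otimes>\<^sub>a (\<lbrakk>g\<^sub>1\<rbrakk> \<odot>\<^sub>a \<lbrakk>g\<^sub>2\<rbrakk>)) \<cdot> (\<one> \<lbrakk>src f\<rbrakk>\<^sub>o \<otimes>\<^sub>a \<lbrakk>e\<rbrakk>)"
      using w 1 by (simp add: ten_interchange ev_basic)
    show ?thesis
      by (rule liftsI[where f\<^sub>1 = "f \<otimes>\<^sub>t g\<^sub>1" and f\<^sub>2 = g\<^sub>2],
          simp, rule cut.ten_right, rule 1(1))
        (use w in \<open>simp_all add: 1(3,5) h h[THEN comp_extend2] right(1,2) ev_basic
          slides slides[THEN comp_extend2]\<close>)
  qed
qed

text \<open>At the root the components are \<open>f\<close> and \<open>g\<close> themselves;
  elsewhere the argument for tensors applies, with \<beta> or its inverse in place of the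
  distributors.\<close>

lemma lifts_Par:
  assumes f: "wf_term k S f" "\<And>L R c. cut k (tgt f) L R c \<Longrightarrow> lifts (\<lambda>_. True) f L R c"
    and g: "wf_term k S g" "\<And>L R c. cut k (tgt g) L R c \<Longrightarrow> lifts (\<lambda>_. True) g L R c"
    and c: "cut k (tgt f \<odot>\<^sub>e tgt g) L R c"
  shows "lifts (\<lambda>_. True) (f \<odot>\<^sub>t g) L R c"
  using c
proof (cases rule: cut_ParE)
  case root
  show ?thesis
    by (rule liftsI[where f\<^sub>1 = f and f\<^sub>2 = g],
        simp, rule cut.root)
      (use f(1) g(1) wf_src_tgt[OF f(1)] wf_src_tgt[OF g(1)] in \<open>simp_all add: root ev_basic\<close>)
next
  case (left X d)
  interpret ld_category \<C> using model left(3) by (simp add: ld_model_def)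
  from left(3,4) have d: "cut k (tgt f) L X d" by simp
  from f(2)[OF d] show ?thesis
  proof (cases rule: liftsE)
    case (1 f\<^sub>1 f\<^sub>2 e)
    note w = f(1) g(1) 1(2,4) wf_src_tgt[OF f(1)] wf_src_tgt[OF g(1)]
      wf_src_tgt[OF 1(2)] wf_src_tgt[OF 1(4)]
      cut_simps[OF d] cut_simps[OF 1(1)]
    have h: "(\<lbrakk>d\<rbrakk> \<odot>\<^sub>a \<one> \<lbrakk>tgt g\<rbrakk>\<^sub>o) \<cdot> (\<lbrakk>f\<rbrakk> \<odot>\<^sub>a \<lbrakk>g\<rbrakk>)
      = ((\<lbrakk>f\<^sub>1\<rbrakk> \<odot>\<^sub>a \<lbrakk>f\<^sub>2\<rbrakk>) \<odot>\<^sub>a \<lbrakk>g\<rbrakk>) \<cdot> (\<lbrakk>e\<rbrakk> \<odot>\<^sub>a \<one> \<lbrakk>src g\<rbrakk>\<^sub>o)"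
      using w 1 by (simp add: par_interchange ev_basic)
    show ?thesis
      by (rule liftsI[where f\<^sub>1 = f\<^sub>1 and f\<^sub>2 = "f\<^sub>2 \<odot>\<^sub>t g"],
          simp, rule cut.par_left[OF left(3)], rule 1(1))
        (use w in \<open>simp_all add: 1(3,5) h left(1,2) ev_basic assoc_par_inv_simps
          assoc_par_inv_slide assoc_par_inv_slide[THEN comp_extend2]\<close>)
  qed
next
  case (right X d)
  from g(2)[OF right(3)] show ?thesis
  proof (cases rule: liftsE)
    case (1 g\<^sub>1 g\<^sub>2 e)
    note w = f(1) g(1) 1(2,4) wf_src_tgt[OF f(1)] wf_src_tgt[OF g(1)]
      wf_src_tgt[OF 1(2)] wf_src_tgt[OF 1(4)]
      cut_simps[OF right(3)] cut_simps[OF 1(1)]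
    have h: "(\<one> \<lbrakk>tgt f\<rbrakk>\<^sub>o \<odot>\<^sub>a \<lbrakk>d\<rbrakk>) \<cdot> (\<lbrakk>f\<rbrakk> \<odot>\<^sub>a \<lbrakk>g\<rbrakk>)
      = (\<lbrakk>f\<rbrakk> \<odot>\<^sub>a (\<lbrakk>g\<^sub>1\<rbrakk> \<odot>\<^sub>a \<lbrakk>g\<^sub>2\<rbrakk>)) \<cdot> (\<one> \<lbrakk>src f\<rbrakk>\<^sub>o \<odot>\<^sub>a \<lbrakk>e\<rbrakk>)"
      using w 1 by (simp add: par_interchange ev_basic)
    show ?thesis
      by (rule liftsI[where f\<^sub>1 = "f \<odot>\<^sub>t g\<^sub>1" and f\<^sub>2 = g\<^sub>2],
          simp, rule cut.par_right, rule 1(1))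
        (use w in \<open>simp_all add: 1(3,5) h right(1,2) ev_basic slides slides[THEN comp_extend2]\<close>)
  qed
qed

text \<open>Lifting squares paste: the cut of \<open>src g\<close> found for \<open>g\<close> is the
  one then lifted along \<open>f\<close>.\<close>

lemma lifts_Cmp:
  assumes w: "wf_term k S (g \<circ>\<^sub>t f)" and o: "cut k (tgt g) L R c" and g: "lifts (\<lambda>_. True) g L R c"
    and f: "\<And>L R c. cut k (tgt f) L R c \<Longrightarrow> lifts (\<lambda>_. True) f L R c"
  shows "lifts (\<lambda>_. True) (g \<circ>\<^sub>t f) L R c"
proof -
  from g obtain g\<^sub>1 g\<^sub>2 d where 1: "cut k (src g) (src g\<^sub>1) (src g\<^sub>2) d" "wf_term k S g\<^sub>1" "L = tgt g\<^sub>1"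
    "wf_term k S g\<^sub>2" "R = tgt g\<^sub>2" "\<lbrakk>c\<rbrakk> \<cdot> \<lbrakk>g\<rbrakk> = (\<lbrakk>g\<^sub>1\<rbrakk> \<odot>\<^sub>a \<lbrakk>g\<^sub>2\<rbrakk>) \<cdot> \<lbrakk>d\<rbrakk>"
    by (rule liftsE)
  have gf: "src g = tgt f" using w by simp
  with 1 f[of "src g\<^sub>1" "src g\<^sub>2" d] obtain f\<^sub>1 f\<^sub>2 e where 2: "cut k (src f) (src f\<^sub>1) (src f\<^sub>2) e"
    "wf_term k S f\<^sub>1" "src g\<^sub>1 = tgt f\<^sub>1" "wf_term k S f\<^sub>2" "src g\<^sub>2 = tgt f\<^sub>2"
    "\<lbrakk>d\<rbrakk> \<cdot> \<lbrakk>f\<rbrakk> = (\<lbrakk>f\<^sub>1\<rbrakk> \<odot>\<^sub>a \<lbrakk>f\<^sub>2\<rbrakk>) \<cdot> \<lbrakk>e\<rbrakk>"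
    by (auto elim: liftsE)
  note s = w gf 1 2 wf_src_tgt[of k S f] wf_src_tgt[of k S g] cut_simps[OF o] cut_simps[OF 1(1)]
    cut_simps[OF 2(1)]
  have "\<lbrakk>c\<rbrakk> \<cdot> \<lbrakk>g\<rbrakk> \<cdot> \<lbrakk>f\<rbrakk> = (\<lbrakk>c\<rbrakk> \<cdot> \<lbrakk>g\<rbrakk>) \<cdot> \<lbrakk>f\<rbrakk>"
    using s(1,2) s(15-) by (simp add: cat_simps evalA_simps)
  also have "\<dots> = (\<lbrakk>g\<^sub>1\<rbrakk> \<odot>\<^sub>a \<lbrakk>g\<^sub>2\<rbrakk>) \<cdot> \<lbrakk>d\<rbrakk> \<cdot> \<lbrakk>f\<rbrakk>"
    unfolding 1(6) using s by (simp add: typing_simps evalA_simps)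
  also have "\<dots> = ((\<lbrakk>g\<^sub>1\<rbrakk> \<odot>\<^sub>a \<lbrakk>g\<^sub>2\<rbrakk>) \<cdot> (\<lbrakk>f\<^sub>1\<rbrakk> \<odot>\<^sub>a \<lbrakk>f\<^sub>2\<rbrakk>)) \<cdot> \<lbrakk>e\<rbrakk>"
    unfolding 2(6) using s by (simp add: typing_simps evalA_simps)
  also have "\<dots> = (\<lbrakk>g\<^sub>1 \<circ>\<^sub>t f\<^sub>1\<rbrakk> \<odot>\<^sub>a \<lbrakk>g\<^sub>2 \<circ>\<^sub>t f\<^sub>2\<rbrakk>) \<cdot> \<lbrakk>e\<rbrakk>"
    using s by (simp add: par_interchange evalA_simps)
  finally show ?thesis
    using 1 2 by (intro liftsI[where f\<^sub>1 = "g\<^sub>1 \<circ>\<^sub>t f\<^sub>1" and f\<^sub>2 = "g\<^sub>2 \<circ>\<^sub>t f\<^sub>2"]) simp_all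
qed

text \<open>Supplies the second cut that \<open>lifts_inverse\<close> asks for when
  \<open>AlInv\<close> is traded for \<open>Al\<close>.\<close>

lemma cut_reassociate_ten:
  assumes "cut k (A \<otimes>\<^sub>e (B \<otimes>\<^sub>e C)) L R c"
  shows "\<exists>L' R' c'. cut k ((A \<otimes>\<^sub>e B) \<otimes>\<^sub>e C) L' R' c' \<and> leaves L' = leaves L"
  using assms
proof (cases rule: cut_TenE)
  case (left X d)
  then show ?thesis by (blast intro: cut.ten_left)
next
  case (right X d)
  from right(3) show ?thesis
  proof (cases rule: cut_TenE)
    case (left Y e)
    then show ?thesis using right(1) by (blast intro: cut.ten_left cut.ten_right)
  next
    case (right Y e)
    \<comment> \<open>Here the left part is a rebracketing of \<open>L\<close>, not \<open>L\<close>
      itself; only the leaf counts agree.\<close>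
    then have "cut k ((A \<otimes>\<^sub>e B) \<otimes>\<^sub>e C) ((A \<otimes>\<^sub>e B) \<otimes>\<^sub>e Y) R
        (Dl (A \<otimes>\<^sub>e B) Y R \<circ>\<^sub>t (Idt (A \<otimes>\<^sub>e B) \<otimes>\<^sub>t e))"
      by (intro cut.ten_right)
    with right \<open>L = _\<close> show ?thesis by (intro exI conjI) auto
  qed
qed

text \<open>The outer par and all pars inside \<open>A\<close> or \<open>B\<close> end up below the
  left argument of the rebracketed par, where cutting requires \<open>LD\<close>.\<close>

lemma cut_reassociate_par:
  assumes ld: "k = LD" and "cut k (A \<odot>\<^sub>e (B \<odot>\<^sub>e C)) L R c"
  shows "\<exists>L' R' c'. cut k ((A \<odot>\<^sub>e B) \<odot>\<^sub>e C) L' R' c' \<and> leaves L' = leaves L"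
  using assms(2)
proof (cases rule: cut_ParE)
  case root
  then show ?thesis using ld by (blast intro: cut.par_left cut.root)
next
  case (left X d)
  then show ?thesis using ld by (blast intro: cut.par_left)
next
  case (right X d)
  from right(3) show ?thesis
  proof (cases rule: cut_ParE)
    case root
    have "cut k ((A \<odot>\<^sub>e B) \<odot>\<^sub>e C) (A \<odot>\<^sub>e B) C (Idt ((A \<odot>\<^sub>e B) \<odot>\<^sub>e C))" by (rule cut.root)
    then show ?thesis using root right(1) by (intro exI conjI) auto
  next
    case (left Y e)
    then show ?thesis using ld right(1) by (blast intro: cut.par_left cut.par_right)
  next
    case (right Y e)
    then have "cut k ((A \<odot>\<^sub>e B) \<odot>\<^sub>e C) ((A \<odot>\<^sub>e B) \<odot>\<^sub>e Y) R
        (Be (A \<odot>\<^sub>e B) Y R \<circ>\<^sub>t (Idt (A \<odot>\<^sub>e B) \<odot>\<^sub>t e))"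
      by (intro cut.par_right)
    with right \<open>L = _\<close> show ?thesis by (intro exI conjI) auto
  qed
qed

lemma lifts_weaken: "lifts Q f L R c \<Longrightarrow> lifts (\<lambda>_. True) f L R c"
  unfolding lifts_def by blast

lemma cut_lifts:
  "\<lbrakk>wf_term k S f; cut k (tgt f) L R c\<rbrakk> \<Longrightarrow> lifts (\<lambda>_. True) f L R c"
proof (induction f arbitrary: L R c)
  case (Idt A)
  then have "A \<in> exprs S" "cut k A L R c" by simp_all
  note s = cut_simps[OF this(2,1)] this
  show ?case
    by (rule liftsI[where f\<^sub>1 = "Idt L" and f\<^sub>2 = "Idt R" and c = c])
      (use s in \<open>simp_all add: par_ident ident_comp\<close>)
next
  case (Al A B C)
  then show ?case using lifts_weaken[OF lifts_Al[of A B C L R c]] by simp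
next
  case (Be A B C)
  then show ?case using lifts_weaken[OF lifts_Be[of A B C L R c]] by simp
next
  case (Dl A B C)
  then show ?case using lifts_Dl[of A B C L R c] by simp
next
  case (Dr A B C)
  then show ?case using lifts_Dr[of A B C L R c] by simp
next
  case (AlInv A B C)
  then have o: "k = LD" "A \<in> exprs S" "B \<in> exprs S" "C \<in> exprs S" by simp_all
  from AlInv(2) obtain L' R' c' where c': "cut k ((A \<otimes>\<^sub>e B) \<otimes>\<^sub>e C) L' R' c'" "leaves L' = leaves L"
    using cut_reassociate_ten by force
  show ?case
    using AlInv(2) c' o lifts_Al[OF o(2-4) c'(1)] eval_inverses(2)[OF o]
    by (intro lifts_inverse[of "Al A B C" "AlInv A B C" L' R' c']) simp_all
next
  case (BeInv A B C)
  then have o: "k = LD" "A \<in> exprs S" "B \<in> exprs S" "C \<in> exprs S" by simp_all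
  from BeInv(2) obtain L' R' c' where c': "cut k ((A \<odot>\<^sub>e B) \<odot>\<^sub>e C) L' R' c'" "leaves L' = leaves L"
    using cut_reassociate_par[OF o(1)] by force
  show ?case
    using BeInv(2) c' o lifts_Be[OF o(2-4) c'(1)] eval_inverses(4)[OF o]
    by (intro lifts_inverse[of "Be A B C" "BeInv A B C" L' R' c']) simp_all
next
  case (Cmp g f)
  then show ?case by (intro lifts_Cmp) simp_all
next
  case (TenT f g)
  then show ?case by (intro lifts_Ten) simp_all
next
  case (ParT f g)
  then show ?case by (intro lifts_Par) simp_all
qed

section \<open>Arrows into a par and arrows on a single leaf\<close>

text \<open>The induction hypothesis is the premise \<open>smaller\<close>, so that this step can be
  taken both in a model and in its dual.\<close>

lemma evalA_unique_into_par:
  assumes smaller: "\<And>f g. \<lbrakk>wf_term k S f; wf_term k S g; src f = src g; tgt f = tgt g; leaves (src f) < n\<rbrakk>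
      \<Longrightarrow> \<lbrakk>f\<rbrakk> = \<lbrakk>g\<rbrakk>"
    and f: "wf_term k S f" and g: "wf_term k S g" and fg: "src f = src g" "tgt f = tgt g"
    and n: "leaves (src f) = n" and B: "tgt f = B \<odot>\<^sub>e B'"
  shows "\<lbrakk>f\<rbrakk> = \<lbrakk>g\<rbrakk>"
proof -
  \<comment> \<open>The root cut is an identity, so lifting it factors \<open>f\<close> itself
    through a cut of its source.\<close>
  have c: "cut k (tgt f) B B' (Idt (tgt f))" unfolding B by (rule cut.root)
  from cut_lifts[OF f c] obtain f\<^sub>1 f\<^sub>2 d where 1: "cut k (src f) (src f\<^sub>1) (src f\<^sub>2) d"
    "wf_term k S f\<^sub>1" "B = tgt f\<^sub>1" "wf_term k S f\<^sub>2" "B' = tgt f\<^sub>2"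
    "\<lbrakk>Idt (tgt f)\<rbrakk> \<cdot> \<lbrakk>f\<rbrakk> = (\<lbrakk>f\<^sub>1\<rbrakk> \<odot>\<^sub>a \<lbrakk>f\<^sub>2\<rbrakk>) \<cdot> \<lbrakk>d\<rbrakk>"
    by (rule liftsE)
  from cut_lifts[OF g c[unfolded fg(2)], folded fg(2)] obtain
    g\<^sub>1 g\<^sub>2 e where 2: "cut k (src g) (src g\<^sub>1) (src g\<^sub>2) e"
    "wf_term k S g\<^sub>1" "B = tgt g\<^sub>1" "wf_term k S g\<^sub>2" "B' = tgt g\<^sub>2"
    "\<lbrakk>Idt (tgt f)\<rbrakk> \<cdot> \<lbrakk>g\<rbrakk> = (\<lbrakk>g\<^sub>1\<rbrakk> \<odot>\<^sub>a \<lbrakk>g\<^sub>2\<rbrakk>) \<cdot> \<lbrakk>e\<rbrakk>"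
    by (rule liftsE)
  \<comment> \<open>Both left components end in \<open>B\<close>, so the two cuts of the common
    source have the same position and coincide.\<close>
  have "leaves (src f\<^sub>1) = leaves (src g\<^sub>1)"
    using leaves_src_tgt[OF 1(2)] leaves_src_tgt[OF 2(2)] 1(3) 2(3) by simp
  with cut_unique[OF 1(1) 2(1)[folded fg(1)]]
  have s: "src f\<^sub>1 = src g\<^sub>1" "src f\<^sub>2 = src g\<^sub>2" "d = e" by simp_all
  have "leaves (src f\<^sub>1) < n" "leaves (src f\<^sub>2) < n"
    using cut_leaves[OF 1(1)] n leaves_pos[of "src f\<^sub>1"] leaves_pos[of "src f\<^sub>2"] by simp_all
  then have "\<lbrakk>f\<^sub>1\<rbrakk> = \<lbrakk>g\<^sub>1\<rbrakk>" "\<lbrakk>f\<^sub>2\<rbrakk> = \<lbrakk>g\<^sub>2\<rbrakk>"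
    using smaller[OF 1(2) 2(2) s(1)] smaller[OF 1(4) 2(4) s(2)] 1(3,5) 2(3,5) by simp_all
  then have "\<one> \<lbrakk>tgt f\<rbrakk>\<^sub>o \<cdot> \<lbrakk>f\<rbrakk> = \<one> \<lbrakk>tgt g\<rbrakk>\<^sub>o \<cdot> \<lbrakk>g\<rbrakk>"
    using 1(6) 2(6) s(3) fg(2) by simp
  then show ?thesis
    using evalA_simps[OF f] evalA_simps[OF g] by (simp add: ident_comp)
qed

text \<open>Associators, distributors and products have at least two leaves, so only composites of
  identities remain.\<close>

lemma single_leaf:
  "\<lbrakk>wf_term k S f; leaves (src f) = 1\<rbrakk> \<Longrightarrow> tgt f = src f \<and> \<lbrakk>f\<rbrakk> = \<one> \<lbrakk>src f\<rbrakk>\<^sub>o"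
proof (induction f)
  case (Cmp g f)
  then have f: "tgt f = src f" "\<lbrakk>f\<rbrakk> = \<one> \<lbrakk>src f\<rbrakk>\<^sub>o" by simp_all
  with Cmp have g: "src g = src f" "tgt g = src f" "\<lbrakk>g\<rbrakk> = \<one> \<lbrakk>src f\<rbrakk>\<^sub>o" by simp_all
  have "src f \<in> exprs S" using Cmp.prems(1) wf_src_tgt[of k S f] by simp
  then show ?case by (simp add: f g ident_simps ident_comp evalO_Ob)
qed (simp_all add: add_is_1 neq0_conv[THEN iffD2, OF leaves_pos])

end

text \<open>Distributors turn a tensor root into a par root, and no generator goes back.\<close>

lemma src_par_tgt_par:
  "\<lbrakk>wf_term k S f; src f = A \<odot>\<^sub>e B\<rbrakk> \<Longrightarrow> \<exists>A' B'. tgt f = A' \<odot>\<^sub>e B'"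
proof (induction f arbitrary: A B)
  case (Cmp g f)
  then show ?case by (metis src.simps(8) tgt.simps(8) wf_term.simps(8))
qed auto

section \<open>Uniqueness of formal arrows\<close>

primrec dual_expr :: "'a expr \<Rightarrow> 'a expr" where
  "dual_expr (Gen a) = Gen a"
| "dual_expr (A \<otimes>\<^sub>e B) = dual_expr B \<odot>\<^sub>e dual_expr A"
| "dual_expr (A \<odot>\<^sub>e B) = dual_expr B \<otimes>\<^sub>e dual_expr A"

primrec dual_term :: "'a arrow_term \<Rightarrow> 'a arrow_term" where
  "dual_term (Idt A) = Idt (dual_expr A)"
| "dual_term (Al A B C) = Be (dual_expr C) (dual_expr B) (dual_expr A)"
| "dual_term (AlInv A B C) = BeInv (dual_expr C) (dual_expr B) (dual_expr A)"
| "dual_term (Be A B C) = Al (dual_expr C) (dual_expr B) (dual_expr A)"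
| "dual_term (BeInv A B C) = AlInv (dual_expr C) (dual_expr B) (dual_expr A)"
| "dual_term (Dl A B C) = Dl (dual_expr C) (dual_expr B) (dual_expr A)"
| "dual_term (Dr A B C) = Dr (dual_expr C) (dual_expr B) (dual_expr A)"
| "dual_term (g \<circ>\<^sub>t f) = dual_term f \<circ>\<^sub>t dual_term g"
| "dual_term (f \<otimes>\<^sub>t g) = dual_term g \<odot>\<^sub>t dual_term f"
| "dual_term (f \<odot>\<^sub>t g) = dual_term g \<otimes>\<^sub>t dual_term f"

lemma dual_expr_in [simp]: "dual_expr A \<in> exprs S \<longleftrightarrow> A \<in> exprs S"
  by (induction A) auto

lemma leaves_dual [simp]: "leaves (dual_expr A) = leaves A"
  by (induction A) auto

lemma dual_term_simps [simp]:
  "src (dual_term f) = dual_expr (tgt f)" "tgt (dual_term f) = dual_expr (src f)"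
  by (induction f) auto

lemma wf_dual_term: "wf_term k S f \<Longrightarrow> wf_term k S (dual_term f)"
  by (induction f) auto

text \<open>Reversing composition merely swaps the two inverse laws.\<close>

lemma inv_arrow_dual [simp]: "inv_arrow (dual \<C>) f = inv_arrow \<C> f"
  by (auto simp: inv_arrow_def inverse_arrows_def intro!: arg_cong[where f = The])

lemma evalO_dual: "evalO (dual \<C>) \<phi> (dual_expr A) = evalO \<C> \<phi> A"
  by (induction A) auto

text \<open>Equality of evaluations can thus be tested in the dual, where a tensor source has become
  a par target.\<close>

lemma evalA_dual: "evalA (dual \<C>) \<phi> (dual_term f) = evalA \<C> \<phi> f"
  by (induction f) (auto simp: evalO_dual)

lemma ld_model_dual: "ld_model k \<C> \<Longrightarrow> ld_model k (dual \<C>)"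
proof -
  assume m: "ld_model k \<C>"
  interpret d: lax_ld_category "dual \<C>"
    using m by (simp add: ld_model_def lax_ld_category_dual)
  have "iso_arrow (dual \<C>) f \<longleftrightarrow> iso_arrow \<C> f" for f
    by (auto simp: iso_arrow_def inverse_arrows_def)
  then have "ld_category (dual \<C>)" if "ld_category \<C>"
    using that by unfold_locales (simp_all add: ld_category.assoc_ten_iso ld_category.assoc_par_iso)
  with m show ?thesis
    by (simp add: ld_model_def d.lax_ld_category_axioms)
qed

text \<open>The induction ranges over all models at once, because the tensor case calls the
  hypothesis in the dual.\<close>

theorem evalA_unique:
  fixes \<C> :: "('o, 'm) ld_structure"
  assumes "ld_model k \<C>" "\<And>a. a \<in> S \<Longrightarrow> \<phi> a \<in> Ob \<C>"
    and "wf_term k S f" "wf_term k S g" "src f = src g" "tgt f = tgt g"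
  shows "evalA \<C> \<phi> f = evalA \<C> \<phi> g"
  using assms
proof (induction "leaves (src f)" arbitrary: \<C> f g rule: less_induct)
  case less
  note m = less.prems(1,2) and fg = less.prems(3-6)
  \<comment> \<open>A par source falls under the first case by
    \<open>src_par_tgt_par\<close>.\<close>
  consider (par) B B' where "tgt f = B \<odot>\<^sub>e B'" | (ten) A A' where "src f = A \<otimes>\<^sub>e A'"
    | (leaf) a where "src f = Gen a"
    using src_par_tgt_par[OF fg(1)] by (cases "src f") auto
  then show ?case
  proof cases
    case par
    show ?thesis
      by (rule evalA_unique_into_par[OF m _ fg HOL.refl par]) (auto intro: less.hyps m)
  next
    case ten
    \<comment> \<open>The dual terms run into a par and have as many leaves as the original
      ones.\<close>
    have "evalA (dual \<C>) \<phi> (dual_term f) = evalA (dual \<C>) \<phi> (dual_term g)"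
    proof (rule evalA_unique_into_par[where n = "leaves (src f)"])
      show "leaves (src (dual_term f)) = leaves (src f)"
        using leaves_src_tgt[OF fg(1)] by simp
      show "tgt (dual_term f) = dual_expr A' \<odot>\<^sub>e dual_expr A" by (simp add: ten)
      show "evalA (dual \<C>) \<phi> f' = evalA (dual \<C>) \<phi> g'"
        if "wf_term k S f'" "wf_term k S g'" "src f' = src g'" "tgt f' = tgt g'"
          "leaves (src f') < leaves (src f)" for f' g'
        by (rule less.hyps[OF that(5) ld_model_dual[OF m(1)] _ that(1-4)]) (simp add: m)
    qed (use m fg ld_model_dual wf_dual_term in auto)
    then show ?thesis by (simp add: evalA_dual)
  next
    case leaf
    then show ?thesis
      using single_leaf[OF m fg(1)] single_leaf[OF m fg(2)] fg by simp
  qed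
qed

section \<open>Thinness of the free categories and formal diagrams\<close>

lemma ld_model_free: "ld_model k (free k S)"
  by (auto simp: ld_model_def free_is_lax_ld free_is_ld)

text \<open>The identity functor is strict and fixes the generators, so by uniqueness it is the lift
  of \<open>Gen\<close>.\<close>

lemma evalA_free:
  assumes "wf_term k S t" shows "evalA (free k S) Gen t = cls k S t"
proof -
  let ?I = "\<lparr>onO = (\<lambda>A. A), onA = (\<lambda>X. X)\<rparr> :: ('a expr, 'a arrow_term set, 'a expr, 'a arrow_term set) fctr"
  have "strict_ld_functor (free k S) (free k S) ?I"
    by (auto simp: strict_ld_functor_def is_functor_def)
  then have "eq_functor_on (free k S) ?I (free_lift (free k S) Gen)"
    by (intro free_lift_unique[OF ld_model_free]) simp_all
  then show ?thesis
    using assms free_lift_cls[OF ld_model_free, of S Gen k S t] by (simp add: eq_functor_on_def)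
qed

text \<open>\<open>evalA_unique\<close> is applied with the free category itself as the model, where
  a term evaluates to its own class.\<close>

lemma thin_free: "thin (free k S)"
  unfolding thin_def
proof (intro ballI)
  fix A B X Y assume "X \<in> hom (free k S) A B" "Y \<in> hom (free k S) A B"
  then obtain f g where "X = cls k S f" "wf_term k S f" "Y = cls k S g" "wf_term k S g"
    "src f = src g" "tgt f = tgt g"
    by (auto simp: free_hom)
  then show "X = Y"
    using evalA_unique[of k "free k S" S Gen f g] by (simp add: ld_model_free evalA_free)
qed

text \<open>The images of parallel arrows already agree in the free category, before the counit is
  applied.\<close>

lemma formal_diagram_commutes:
  assumes D: "formal_diagram k \<J> \<C> D"
  shows "commutes \<J> D"
  unfolding commutes_def
proof (intro ballI)
  fix i j u v assume ij: "i \<in> Ob \<J>" "j \<in> Ob \<J>" and uv: "u \<in> hom \<J> i j" "v \<in> hom \<J> i j"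
  from D obtain D' where D': "is_functor \<J> (free k (Ob \<C>)) D'"
    and eq: "eq_functor_on \<J> D (comp_functor (counit \<C>) D')"
    by (auto simp: formal_diagram_def)
  have "onA D' u \<in> hom (free k (Ob \<C>)) (onO D' i) (onO D' j)"
    "onA D' v \<in> hom (free k (Ob \<C>)) (onO D' i) (onO D' j)"
    "onO D' i \<in> exprs (Ob \<C>)" "onO D' j \<in> exprs (Ob \<C>)"
    using D' ij uv by (auto simp: is_functor_def)
  then have "onA D' u = onA D' v"
    using thin_free[of k "Ob \<C>"] unfolding thin_def by simp
  then show "onA D u = onA D v"
    using eq uv by (simp add: eq_functor_on_def comp_functor_def hom_def)
qed

theorem theorem5p7:
  shows "(\<forall>S :: 'a set. thin (free_ld S)) \<and>
    (\<forall>(\<C> :: ('o, 'm) ld_structure) (\<J> :: ('j, 'k) category) D.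
       ld_category \<C> \<longrightarrow> category \<J> \<longrightarrow> formal_diagram LD \<J> \<C> D \<longrightarrow> commutes \<J> D) \<and>
    (\<forall>S :: 'a set. thin (free_lax_ld S)) \<and>
    (\<forall>(\<C> :: ('o, 'm) ld_structure) (\<J> :: ('j, 'k) category) D.
       lax_ld_category \<C> \<longrightarrow> category \<J> \<longrightarrow> formal_diagram Lax \<J> \<C> D \<longrightarrow> commutes \<J> D)"
  by (blast intro: thin_free formal_diagram_commutes)

end
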